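(* Let $d\ge1$, $q\in(0,2)$ and $\mu_n,\mu\in\mathcal P_{q/2}(\mathbb R^d)$ ($n\in\mathbb N$). (1) If $\mathsf T_{q/2}(\mu_n,\mu)\to0$, then $\mathrm{MMD}_q(\mu_n,\mu)\to0$. (2) If $\mathrm{MMD}_q(\mu_n,\mu)\to0$, then $\mathsf T_r(\mu_n,\mu)\to0$ for every $0<r<q/2$.
   Context: $\mathcal P_s(\mathbb R^d)$: Borel probability measures with finite $s$-th moment. $\mathrm{MMD}_q\ge0$ is defined by $\mathrm{MMD}_q^2(\rho,\mu):=\frac12\iint(|x|^q+|y|^q-|x-y|^q)\,\mathrm d(\rho-\mu)(x)\,\mathrm d(\rho-\mu)(y)$ for $\rho,\mu\in\mathcal P_{q/2}(\mathbb R^d)$. For $r>0$, $\mathsf T_r(\rho,\mu):=\inf_{\pi\in\Gamma(\rho,\mu)}\int|x-y|^r\,\mathrm d\pi(x,y)$, where $\Gamma(\rho,\mu)$ is the set of couplings of $\rho$ and $\mu$. *)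

theory Defs
  imports "HOL-Probability.Probability"
begin

definition prob_moment :: "real \<Rightarrow> 'a::euclidean_space measure set" where
  "prob_moment s = {\<mu>. prob_space \<mu> \<and> sets \<mu> = sets borel \<and> integrable \<mu> (\<lambda>x. norm x powr s)}"

(* The integral of f against the signed measure \<rho> - \<mu>; only meaningful if f is
   integrable with respect to both \<rho> and \<mu>. *)
definition diff_integral :: "'a measure \<Rightarrow> 'a measure \<Rightarrow> ('a \<Rightarrow> real) \<Rightarrow> real" where
  "diff_integral \<rho> \<mu> f = (\<integral>x. f x \<partial>\<rho>) - (\<integral>x. f x \<partial>\<mu>)"

definition mmd_kernel :: "real \<Rightarrow> 'a::euclidean_space \<Rightarrow> 'a \<Rightarrow> real" where
  "mmd_kernel q x y = norm x powr q + norm y powr q - norm (x - y) powr q"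

(* For 0 < q < 2 the kernel k is positive definite, so
   |k x y| <= sqrt (k x x) * sqrt (k y y) = 2 * |x| powr (q/2) * |y| powr (q/2).
   Hence on prob_moment (q/2) both integrals below converge absolutely (even though the
   single terms |x| powr q need not be integrable), and the radicand is nonnegative. *)
definition MMD :: "real \<Rightarrow> 'a::euclidean_space measure \<Rightarrow> 'a measure \<Rightarrow> real" where
  "MMD q \<rho> \<mu> =
     sqrt (1/2 * diff_integral \<rho> \<mu> (\<lambda>y. diff_integral \<rho> \<mu> (\<lambda>x. mmd_kernel q x y)))"

definition couplings ::
  "'a::euclidean_space measure \<Rightarrow> 'a measure \<Rightarrow> ('a \<times> 'a) measure set" where
  "couplings \<rho> \<mu> =
     {\<pi>. prob_space \<pi> \<and> sets \<pi> = sets borel \<and> distr \<pi> borel fst = \<rho> \<and> distr \<pi> borel snd = \<mu>}"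

definition transport_cost ::
  "real \<Rightarrow> 'a::euclidean_space measure \<Rightarrow> 'a measure \<Rightarrow> ennreal" where
  "transport_cost r \<rho> \<mu> =
     (INF \<pi>\<in>couplings \<rho> \<mu>. \<integral>\<^sup>+ p. ennreal (norm (fst p - snd p) powr r) \<partial>\<pi>)"

end

theory Submission
  imports Defs
begin

text \<open>
  Two ideas carry the proof: a concrete Hilbert space picture of the distance \<open>MMD\<close>, and a
  transport plan built from Gaussian smoothing.

  For \<open>0 < q < 2\<close> the power \<open>|x|^q\<close> is a positive mixture over \<open>s > 0\<close> of the functions
  \<open>1 - exp (- s |x|^2)\<close>, and \<open>exp (- s |x - y|^2)\<close> is, up to a normalisation, the \<open>L2(dz)\<close> inner
  product of the bumps \<open>exp (- 2 s |x - z|^2)\<close> and \<open>exp (- 2 s |y - z|^2)\<close>. Hence the map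
  \<open>feature\<close>, which sends a point \<open>x\<close> to the function \<open>(s, z) \<mapsto> exp (- 2 s |x - z|^2)\<close>, satisfies
  \<open>\<parallel>feature x - feature y\<parallel>^2 = 2 |x - y|^q\<close> in the \<open>L2\<close> space of a suitable measure
  (\<open>feature_distance\<close>). The kernel of \<open>MMD\<close> is then the inner product of features centred at the
  origin, and \<open>MMD^2\<close> is half the squared norm of the difference of the mean features
  (\<open>MMD_eq_L2\<close>); a mean feature is called \<open>potential\<close> below. The first half of the theorem
  is now Minkowski's integral inequality: a coupling writes the difference of the mean features as
  a mean of differences \<open>feature x - feature y\<close>, whose norms are \<open>sqrt 2 |x - y|^(q/2)\<close>
  (\<open>MMD_le_transport_cost\<close>).

  For the second half, observe that at a fixed scale \<open>s\<close> the potential is, up to a constant, the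
  density of the measure smoothed by a Gaussian of variance of order \<open>1/s\<close>. Let \<open>f\<close> and \<open>h\<close> be
  two such smoothed densities. One transports \<open>x\<close> to a random point \<open>z\<close> near \<open>x\<close>, and \<open>z\<close> back to
  a random \<open>y\<close> near \<open>z\<close>; this can be done for the mass \<open>min (f z) (h z)\<close> common to both, and only
  the rest, of size \<open>|f - h|\<close>, has to be transported in an arbitrary way. So the cost is at most
  four times the spread of the Gaussian plus the integral of \<open>|z|^r |f - h|\<close>
  (\<open>transport_cost_le_mollify\<close>). The spread is small when \<open>s\<close> is large. On a ball, the
  integral is at most a constant times the \<open>L2\<close> norm of \<open>f - h\<close>, which \<open>MMD\<close> controls for
  at least one \<open>s\<close> in each interval \<open>[T, T + 1]\<close> (\<open>exists_scale_L2_le\<close>). Outside the ball it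
  is controlled by moments of an order \<open>p\<close> with \<open>r < p < q/2\<close>.

  These moments stay bounded along the sequence because a function comparable to \<open>|x|^p\<close> is
  the pairing of \<open>feature x - feature 0\<close> with a fixed square integrable function
  (\<open>moment_bound\<close>), so that its mean is Lipschitz with respect to \<open>MMD\<close>. That function
  is square integrable precisely for \<open>p < q/2\<close>, which is why \<open>r\<close> has to stay below \<open>q/2\<close>.
\<close>

section \<open>A transport plan from smoothing\<close>

lemma powr_add_le:
  fixes a b r :: real
  assumes "0 \<le> a" "0 \<le> b" "0 < r" "r \<le> 1"
  shows "(a + b) powr r \<le> a powr r + b powr r"
proof (cases "a + b = 0")
  case False
  define c where "c = a + b"
  have c: "c > 0" using False assms by (simp add: c_def)
  have *: "t / c * c powr r \<le> t powr r" if "0 \<le> t" "t \<le> c" for t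
  proof (cases "t = 0")
    case False
    have "t / c = (t / c) powr 1" using that c by simp
    also have "\<dots> \<le> (t / c) powr r"
      using that c False assms by (intro powr_mono') auto
    also have "\<dots> = t powr r / c powr r" using that c by (simp add: powr_divide)
    finally show ?thesis using c by (simp add: field_simps)
  qed auto
  have "a / c + b / c = 1"
    using c by (simp add: c_def add_divide_distrib[symmetric])
  then have "c powr r = a / c * c powr r + b / c * c powr r"
    by (metis distrib_right mult_1)
  also have "\<dots> \<le> a powr r + b powr r"
    using * assms by (intro add_mono) (auto simp: c_def)
  finally show ?thesis by (simp add: c_def)
qed (use assms in auto)

lemma norm_diff_powr_le:
  fixes x y z :: "'a::real_normed_vector"
  assumes "0 < r" "r \<le> 1"
  shows "norm (x - y) powr r \<le> norm (x - z) powr r + norm (y - z) powr r"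
proof -
  have "norm (x - y) \<le> norm (x - z) + norm (y - z)"
    using norm_triangle_ineq4[of "x - z" "y - z"] by simp
  then have "norm (x - y) powr r \<le> (norm (x - z) + norm (y - z)) powr r"
    using assms by (intro powr_mono2) auto
  also have "\<dots> \<le> norm (x - z) powr r + norm (y - z) powr r"
    using assms by (intro powr_add_le) auto
  finally show ?thesis .
qed

text \<open>
  The marginal conditions are only imposed almost everywhere, because the density used below has
  the form \<open>a x * b y / \<tau>\<close> with a normalisation \<open>\<tau>\<close> that vanishes when the two measures agree.
\<close>

lemma density_in_couplings:
  fixes \<rho> \<mu> :: "'a::euclidean_space measure"
  assumes "prob_space \<rho>" "prob_space \<mu>" and s: "sets \<rho> = sets borel" "sets \<mu> = sets borel"
    and H: "H \<in> borel_measurable (borel \<Otimes>\<^sub>M borel)"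
    and m1: "AE x in \<rho>. (\<integral>\<^sup>+y. H (x, y) \<partial>\<mu>) = 1"
    and m2: "AE y in \<mu>. (\<integral>\<^sup>+x. H (x, y) \<partial>\<rho>) = 1"
  shows "density (\<rho> \<Otimes>\<^sub>M \<mu>) H \<in> couplings \<rho> \<mu>"
proof -
  interpret R: prob_space \<rho> by fact
  interpret M: prob_space \<mu> by fact
  interpret P: pair_prob_space \<rho> \<mu> ..
  note s [measurable_cong]
  have H' [measurable]: "H \<in> borel_measurable (\<rho> \<Otimes>\<^sub>M \<mu>)"
    using H by (simp cong: measurable_cong_sets sets_pair_measure_cong add: s)
  let ?\<pi> = "density (\<rho> \<Otimes>\<^sub>M \<mu>) H"
  have sets: "sets ?\<pi> = sets borel"
    using sets_pair_measure_cong[OF s] unfolding borel_prod by simp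
  have fst_meas: "fst \<in> measurable ?\<pi> borel" and snd_meas: "snd \<in> measurable ?\<pi> borel"
    by measurable
  have d1: "distr ?\<pi> borel fst = \<rho>"
  proof (rule measure_eqI)
    fix A assume "A \<in> sets (distr ?\<pi> borel fst)"
    then have A [measurable]: "A \<in> sets borel" by simp
    have A': "fst -` A \<inter> space ?\<pi> \<in> sets (\<rho> \<Otimes>\<^sub>M \<mu>)"
      using measurable_sets[OF fst_meas A] unfolding sets_density .
    have "emeasure (distr ?\<pi> borel fst) A = (\<integral>\<^sup>+p. H p * indicator (fst -` A \<inter> space ?\<pi>) p \<partial>(\<rho> \<Otimes>\<^sub>M \<mu>))"
      by (simp only: emeasure_distr[OF fst_meas A] emeasure_density[OF H' A'])
    also have "\<dots> = (\<integral>\<^sup>+p. H p * indicator A (fst p) \<partial>(\<rho> \<Otimes>\<^sub>M \<mu>))"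
      by (intro nn_integral_cong) (auto simp: indicator_def)
    also have "\<dots> = (\<integral>\<^sup>+x. (\<integral>\<^sup>+y. H (x, y) * indicator A x \<partial>\<mu>) \<partial>\<rho>)"
      by (subst M.nn_integral_fst[symmetric]) auto
    also have "\<dots> = (\<integral>\<^sup>+x. indicator A x \<partial>\<rho>)"
      using m1 by (intro nn_integral_cong_AE) (auto simp: nn_integral_multc)
    finally show "emeasure (distr ?\<pi> borel fst) A = emeasure \<rho> A" by simp
  qed (simp add: s)
  have d2: "distr ?\<pi> borel snd = \<mu>"
  proof (rule measure_eqI)
    fix A assume "A \<in> sets (distr ?\<pi> borel snd)"
    then have A [measurable]: "A \<in> sets borel" by simp
    have A': "snd -` A \<inter> space ?\<pi> \<in> sets (\<rho> \<Otimes>\<^sub>M \<mu>)"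
      using measurable_sets[OF snd_meas A] unfolding sets_density .
    have "emeasure (distr ?\<pi> borel snd) A = (\<integral>\<^sup>+p. H p * indicator (snd -` A \<inter> space ?\<pi>) p \<partial>(\<rho> \<Otimes>\<^sub>M \<mu>))"
      by (simp only: emeasure_distr[OF snd_meas A] emeasure_density[OF H' A'])
    also have "\<dots> = (\<integral>\<^sup>+p. H p * indicator A (snd p) \<partial>(\<rho> \<Otimes>\<^sub>M \<mu>))"
      by (intro nn_integral_cong) (auto simp: indicator_def)
    also have "\<dots> = (\<integral>\<^sup>+y. (\<integral>\<^sup>+x. H (x, y) * indicator A y \<partial>\<rho>) \<partial>\<mu>)"
      by (subst P.nn_integral_snd[symmetric]) auto
    also have "\<dots> = (\<integral>\<^sup>+y. indicator A y \<partial>\<mu>)"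
      using m2 by (intro nn_integral_cong_AE) (auto simp: nn_integral_multc)
    finally show "emeasure (distr ?\<pi> borel snd) A = emeasure \<mu> A" by simp
  qed (simp add: s)
  have "prob_space (distr ?\<pi> borel fst)" unfolding d1 by fact
  then have "prob_space ?\<pi>"
    using prob_space_distrD[OF fst_meas] by simp
  then show ?thesis
    using sets d1 d2 by (simp add: couplings_def)
qed

locale smoothing_kernel =
  fixes g :: "'a::euclidean_space \<Rightarrow> 'a \<Rightarrow> real" and B :: real
  assumes g_measurable: "(\<lambda>(x, z). g x z) \<in> borel_measurable (borel \<Otimes>\<^sub>M borel)"
    and g_pos: "\<And>x z. 0 < g x z" and g_le: "\<And>x z. g x z \<le> B"
    and g_mass: "\<And>x. (\<integral>\<^sup>+z. ennreal (g x z) \<partial>lborel) = 1"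
begin

lemma g_measurable' [measurable (raw)]:
  assumes [measurable]: "f \<in> borel_measurable M" "h \<in> borel_measurable M"
  shows "(\<lambda>w. g (f w) (h w)) \<in> borel_measurable M"
  using measurable_compose[OF measurable_Pair[OF assms] g_measurable] by simp

definition mollify :: "'a measure \<Rightarrow> 'a \<Rightarrow> real" where
  "mollify \<nu> z = (\<integral>x. g x z \<partial>\<nu>)"

text \<open>
  Write \<open>p\<close> and \<open>m\<close> for the mollified densities of \<open>\<rho>\<close> and \<open>\<mu>\<close>. The fraction of \<open>p z\<close> that cannot
  be matched with mass of \<open>m z\<close> is \<open>(p z - m z)\<^sup>+ / p z\<close>. In the form chosen here the denominator
  is symmetric in the two measures; the two expressions agree when \<open>m z \<le> p z\<close>, and both
  vanish otherwise.
\<close>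

definition deficit :: "'a measure \<Rightarrow> 'a measure \<Rightarrow> 'a \<Rightarrow> real" where
  "deficit \<rho> \<mu> z = 1 - mollify \<mu> z / max (mollify \<rho> z) (mollify \<mu> z)"

text \<open>
  The share of the mass at \<open>x\<close> that is left unmatched after \<open>x\<close> has been sent to a random \<open>z\<close>.
\<close>

definition excess :: "'a measure \<Rightarrow> 'a measure \<Rightarrow> 'a \<Rightarrow> ennreal" where
  "excess \<rho> \<mu> x = (\<integral>\<^sup>+z. ennreal (g x z * deficit \<rho> \<mu> z) \<partial>lborel)"

text \<open>
  The density, with respect to the product measure, of the plan that goes from \<open>x\<close> to \<open>z\<close> and
  back to \<open>y\<close>, restricted to the mass \<open>min (p z) (m z)\<close>. The conditional laws of \<open>x\<close> and \<open>y\<close> given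
  \<open>z\<close> have densities \<open>g x z / p z\<close> and \<open>g y z / m z\<close>, and \<open>min p m / (p m) = 1 / max p m\<close>.
\<close>

definition shared :: "'a measure \<Rightarrow> 'a measure \<Rightarrow> 'a \<Rightarrow> 'a \<Rightarrow> ennreal" where
  "shared \<rho> \<mu> x y = (\<integral>\<^sup>+z. ennreal (g x z * g y z / max (mollify \<rho> z) (mollify \<mu> z)) \<partial>lborel)"

lemma shared_commute: "shared \<rho> \<mu> x y = shared \<mu> \<rho> y x"
  by (simp add: shared_def max.commute mult.commute)

context
  fixes \<nu> :: "'a measure"
  assumes \<nu>: "prob_space \<nu>" "sets \<nu> = sets borel"
begin

interpretation prob_space \<nu> by (rule \<nu>)

lemma integrable_g: "integrable \<nu> (\<lambda>x. g x z)"
proof -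
  note \<nu>(2) [measurable_cong]
  show ?thesis
    by (rule integrable_const_bound[where B=B]) (auto simp: g_le less_imp_le[OF g_pos])
qed

lemma nn_integral_g: "(\<integral>\<^sup>+x. ennreal (g x z) \<partial>\<nu>) = ennreal (mollify \<nu> z)"
  unfolding mollify_def using integrable_g by (intro nn_integral_eq_integral) (auto simp: less_imp_le[OF g_pos])

lemma mollify_measurable: "mollify \<nu> \<in> borel_measurable borel"
proof -
  note \<nu>(2) [measurable_cong]
  show ?thesis unfolding mollify_def[abs_def] by measurable
qed

lemma mollify_pos: "0 < mollify \<nu> z"
proof -
  note \<nu>(2) [measurable_cong]
  have "\<not> (AE x in \<nu>. ennreal (g x z) = 0)"
    using g_pos by (auto simp: ennreal_eq_0_iff not_le[symmetric] AE_False)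
  then have "(\<integral>\<^sup>+x. ennreal (g x z) \<partial>\<nu>) \<noteq> 0"
    by (subst nn_integral_0_iff_AE) auto
  then show ?thesis
    by (simp add: nn_integral_g ennreal_eq_0_iff not_le)
qed

lemma nn_integral_weighted_mollify:
  assumes [measurable]: "(\<lambda>(x, z). f x z) \<in> borel_measurable (borel \<Otimes>\<^sub>M borel)"
  shows "(\<integral>\<^sup>+x. (\<integral>\<^sup>+z. ennreal (g x z) * f x z \<partial>lborel) \<partial>\<nu>)
     = (\<integral>\<^sup>+z. (\<integral>\<^sup>+x. ennreal (g x z) * f x z \<partial>\<nu>) \<partial>lborel)"
proof -
  note \<nu>(2) [measurable_cong]
  interpret P: pair_sigma_finite \<nu> "lborel :: 'a measure" ..
  show ?thesis by (rule P.Fubini'[symmetric]) measurable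
qed

lemma mollify_mass: "(\<integral>\<^sup>+z. ennreal (mollify \<nu> z) \<partial>lborel) = 1"
  using nn_integral_weighted_mollify[of "\<lambda>_ _. 1"] g_mass
  by (simp add: nn_integral_g emeasure_space_1)

text \<open>
  A point \<open>z\<close> drawn from \<open>g x\<close> satisfies \<open>|z|^r \<le> |x|^r + |x - z|^r\<close>, and the mean of the last term
  is the spread of the kernel.
\<close>

lemma mollify_moment:
  assumes r: "0 < r" "r \<le> 1"
    and e: "\<And>x. (\<integral>\<^sup>+z. ennreal (norm (x - z) powr r * g x z) \<partial>lborel) \<le> e"
  shows "(\<integral>\<^sup>+z. ennreal (norm z powr r * mollify \<nu> z) \<partial>lborel)
    \<le> (\<integral>\<^sup>+x. ennreal (norm x powr r) \<partial>\<nu>) + e"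
proof -
  note \<nu>(2) [measurable_cong]
  note mollify_measurable [measurable]
  have "(\<integral>\<^sup>+z. ennreal (norm z powr r * mollify \<nu> z) \<partial>lborel)
     = (\<integral>\<^sup>+z. (\<integral>\<^sup>+x. ennreal (g x z) * ennreal (norm z powr r) \<partial>\<nu>) \<partial>lborel)"
    by (simp add: nn_integral_multc nn_integral_g ennreal_mult'' mult.commute)
  also have "\<dots> = (\<integral>\<^sup>+x. (\<integral>\<^sup>+z. ennreal (g x z) * ennreal (norm z powr r) \<partial>lborel) \<partial>\<nu>)"
    by (rule nn_integral_weighted_mollify[symmetric]) measurable
  also have "\<dots> \<le> (\<integral>\<^sup>+x. (\<integral>\<^sup>+z. ennreal (norm x powr r) * ennreal (g x z) + ennreal (norm (x - z) powr r * g x z) \<partial>lborel) \<partial>\<nu>)"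
  proof (intro nn_integral_mono)
    fix x z :: 'a
    have "norm z powr r \<le> norm x powr r + norm (x - z) powr r"
      using norm_diff_powr_le[OF r, of z 0 x] by (simp add: norm_minus_commute)
    then have "g x z * norm z powr r \<le> g x z * (norm x powr r + norm (x - z) powr r)"
      by (intro mult_left_mono less_imp_le[OF g_pos])
    then show "ennreal (g x z) * ennreal (norm z powr r) \<le> ennreal (norm x powr r) * ennreal (g x z) + ennreal (norm (x - z) powr r * g x z)"
      using less_imp_le[OF g_pos[of x z]]
      by (simp add: ennreal_mult[symmetric] ennreal_plus[symmetric] algebra_simps del: ennreal_plus)
  qed
  also have "\<dots> = (\<integral>\<^sup>+x. ennreal (norm x powr r) + (\<integral>\<^sup>+z. ennreal (norm (x - z) powr r * g x z) \<partial>lborel) \<partial>\<nu>)"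
    by (simp add: nn_integral_add nn_integral_cmult g_mass)
  also have "\<dots> \<le> (\<integral>\<^sup>+x. ennreal (norm x powr r) + e \<partial>\<nu>)"
    by (intro nn_integral_mono add_left_mono e)
  also have "\<dots> = (\<integral>\<^sup>+x. ennreal (norm x powr r) \<partial>\<nu>) + e"
    by (simp add: nn_integral_add emeasure_space_1)
  finally show ?thesis .
qed

end

lemma deficit_bounds:
  assumes "prob_space \<rho>" "sets \<rho> = sets borel" "prob_space \<mu>" "sets \<mu> = sets borel"
  shows "0 \<le> deficit \<rho> \<mu> z" "deficit \<rho> \<mu> z \<le> 1"
    "mollify \<rho> z * deficit \<rho> \<mu> z = max 0 (mollify \<rho> z - mollify \<mu> z)"
  using mollify_pos[of \<rho> z] mollify_pos[of \<mu> z] assms by (auto simp: deficit_def field_simps max_def)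

context
  fixes \<rho> \<mu> :: "'a measure"
  assumes \<rho>: "prob_space \<rho>" "sets \<rho> = sets borel"
    and \<mu>: "prob_space \<mu>" "sets \<mu> = sets borel"
begin

interpretation R: prob_space \<rho> by (rule \<rho>)
interpretation M: prob_space \<mu> by (rule \<mu>)
lemmas [measurable] = mollify_measurable[OF \<rho>] mollify_measurable[OF \<mu>]

lemma deficit_measurable [measurable]: "deficit \<rho> \<mu> \<in> borel_measurable borel"
  unfolding deficit_def[abs_def] by measurable

lemma excess_measurable [measurable]: "excess \<rho> \<mu> \<in> borel_measurable borel"
  unfolding excess_def[abs_def] by measurable

lemma shared_measurable [measurable]: "(\<lambda>(x, y). shared \<rho> \<mu> x y) \<in> borel_measurable (borel \<Otimes>\<^sub>M borel)"
  unfolding shared_def[abs_def] by measurable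

lemma shared_marginal: "(\<integral>\<^sup>+y. shared \<rho> \<mu> x y \<partial>\<mu>) + excess \<rho> \<mu> x = 1"
proof -
  note [measurable_cong] = \<rho>(2) \<mu>(2)
  interpret P: pair_sigma_finite \<mu> "lborel :: 'a measure" ..
  have pos: "0 < max (mollify \<rho> z) (mollify \<mu> z)" for z
    using mollify_pos[OF \<rho>, of z] by simp
  have "(\<integral>\<^sup>+y. shared \<rho> \<mu> x y \<partial>\<mu>)
    = (\<integral>\<^sup>+z. (\<integral>\<^sup>+y. ennreal (g x z * g y z / max (mollify \<rho> z) (mollify \<mu> z)) \<partial>\<mu>) \<partial>lborel)"
    unfolding shared_def by (rule P.Fubini'[symmetric]) measurable
  also have "\<dots> = (\<integral>\<^sup>+z. ennreal (g x z * (1 - deficit \<rho> \<mu> z)) \<partial>lborel)"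
  proof (intro nn_integral_cong)
    fix z
    have "(\<integral>\<^sup>+y. ennreal (g x z * g y z / max (mollify \<rho> z) (mollify \<mu> z)) \<partial>\<mu>)
      = (\<integral>\<^sup>+y. ennreal (g x z / max (mollify \<rho> z) (mollify \<mu> z)) * ennreal (g y z) \<partial>\<mu>)"
      using pos[of z] g_pos[of x z] by (simp add: ennreal_mult'[symmetric] less_imp_le)
    also have "\<dots> = ennreal (g x z / max (mollify \<rho> z) (mollify \<mu> z)) * ennreal (mollify \<mu> z)"
      by (simp add: nn_integral_cmult nn_integral_g[OF \<mu>])
    also have "\<dots> = ennreal (g x z * (1 - deficit \<rho> \<mu> z))"
      using pos[of z] g_pos[of x z] by (simp add: ennreal_mult'[symmetric] less_imp_le deficit_def)
    finally show "(\<integral>\<^sup>+y. ennreal (g x z * g y z / max (mollify \<rho> z) (mollify \<mu> z)) \<partial>\<mu>)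
       = ennreal (g x z * (1 - deficit \<rho> \<mu> z))" .
  qed
  finally have "(\<integral>\<^sup>+y. shared \<rho> \<mu> x y \<partial>\<mu>) + excess \<rho> \<mu> x
     = (\<integral>\<^sup>+z. ennreal (g x z * (1 - deficit \<rho> \<mu> z)) + ennreal (g x z * deficit \<rho> \<mu> z) \<partial>lborel)"
    by (simp add: excess_def nn_integral_add)
  also have "\<dots> = (\<integral>\<^sup>+z. ennreal (g x z) \<partial>lborel)"
    using deficit_bounds[OF \<rho> \<mu>] less_imp_le[OF g_pos]
    by (intro nn_integral_cong) (simp add: ennreal_plus[symmetric] algebra_simps mult_left_le del: ennreal_plus)
  finally show ?thesis by (simp add: g_mass)
qed

lemma integral_excess:
  "(\<integral>\<^sup>+x. excess \<rho> \<mu> x \<partial>\<rho>) = (\<integral>\<^sup>+z. ennreal (max 0 (mollify \<rho> z - mollify \<mu> z)) \<partial>lborel)"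
proof -
  note [measurable_cong] = \<rho>(2) \<mu>(2)
  have "(\<integral>\<^sup>+x. excess \<rho> \<mu> x \<partial>\<rho>) = (\<integral>\<^sup>+x. (\<integral>\<^sup>+z. ennreal (g x z) * ennreal (deficit \<rho> \<mu> z) \<partial>lborel) \<partial>\<rho>)"
    unfolding excess_def by (simp add: ennreal_mult' less_imp_le[OF g_pos])
  also have "\<dots> = (\<integral>\<^sup>+z. (\<integral>\<^sup>+x. ennreal (g x z) * ennreal (deficit \<rho> \<mu> z) \<partial>\<rho>) \<partial>lborel)"
    by (rule nn_integral_weighted_mollify[OF \<rho>]) measurable
  also have "\<dots> = (\<integral>\<^sup>+z. ennreal (max 0 (mollify \<rho> z - mollify \<mu> z)) \<partial>lborel)"
    using deficit_bounds[OF \<rho> \<mu>]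
    by (simp add: nn_integral_multc nn_integral_g[OF \<rho>] ennreal_mult'[symmetric] less_imp_le[OF mollify_pos[OF \<rho>]])
  finally show ?thesis .
qed

text \<open>
  Once \<open>y\<close> is integrated out, the weight is at most \<open>g x z\<close>. This is one leg of the
  journey from \<open>x\<close> through \<open>z\<close> to \<open>y\<close>; the other leg follows by exchanging the measures.
\<close>

lemma shared_cost:
  assumes e: "\<And>x. (\<integral>\<^sup>+z. ennreal (norm (x - z) powr r * g x z) \<partial>lborel) \<le> e"
  shows "(\<integral>\<^sup>+x. (\<integral>\<^sup>+y. (\<integral>\<^sup>+z. ennreal (norm (x - z) powr r) *
      ennreal (g x z * g y z / max (mollify \<rho> z) (mollify \<mu> z)) \<partial>lborel) \<partial>\<mu>) \<partial>\<rho>) \<le> e"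
proof -
  note [measurable_cong] = \<rho>(2) \<mu>(2)
  interpret P: pair_sigma_finite \<mu> "lborel :: 'a measure" ..
  have pos: "0 < max (mollify \<rho> z) (mollify \<mu> z)" for z
    using mollify_pos[OF \<rho>, of z] by simp
  have "(\<integral>\<^sup>+x. (\<integral>\<^sup>+y. (\<integral>\<^sup>+z. ennreal (norm (x - z) powr r) *
      ennreal (g x z * g y z / max (mollify \<rho> z) (mollify \<mu> z)) \<partial>lborel) \<partial>\<mu>) \<partial>\<rho>)
    = (\<integral>\<^sup>+x. (\<integral>\<^sup>+z. (\<integral>\<^sup>+y. ennreal (norm (x - z) powr r) *
      ennreal (g x z * g y z / max (mollify \<rho> z) (mollify \<mu> z)) \<partial>\<mu>) \<partial>lborel) \<partial>\<rho>)"
    by (intro nn_integral_cong P.Fubini'[symmetric]) measurable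
  also have "\<dots> \<le> (\<integral>\<^sup>+x. (\<integral>\<^sup>+z. ennreal (norm (x - z) powr r * g x z) \<partial>lborel) \<partial>\<rho>)"
  proof (intro nn_integral_mono)
    fix x z
    have "(\<integral>\<^sup>+y. ennreal (norm (x - z) powr r) *
      ennreal (g x z * g y z / max (mollify \<rho> z) (mollify \<mu> z)) \<partial>\<mu>)
      = (\<integral>\<^sup>+y. ennreal (norm (x - z) powr r * g x z / max (mollify \<rho> z) (mollify \<mu> z)) * ennreal (g y z) \<partial>\<mu>)"
      using pos[of z] g_pos[of x z] by (simp add: ennreal_mult'[symmetric] less_imp_le mult.assoc)
    also have "\<dots> = ennreal (norm (x - z) powr r * g x z / max (mollify \<rho> z) (mollify \<mu> z)) * ennreal (mollify \<mu> z)"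
      by (simp add: nn_integral_cmult nn_integral_g[OF \<mu>])
    also have "\<dots> = ennreal ((norm (x - z) powr r * g x z) * (1 - deficit \<rho> \<mu> z))"
      using pos[of z] g_pos[of x z] by (simp add: ennreal_mult'[symmetric] less_imp_le deficit_def)
    also have "\<dots> \<le> ennreal (norm (x - z) powr r * g x z)"
      using deficit_bounds[OF \<rho> \<mu>] less_imp_le[OF g_pos]
      by (intro ennreal_leI mult_left_le) auto
    finally show "(\<integral>\<^sup>+y. ennreal (norm (x - z) powr r) *
      ennreal (g x z * g y z / max (mollify \<rho> z) (mollify \<mu> z)) \<partial>\<mu>) \<le> ennreal (norm (x - z) powr r * g x z)" .
  qed
  also have "\<dots> \<le> (\<integral>\<^sup>+x. e \<partial>\<rho>)"
    by (intro nn_integral_mono e)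
  finally show ?thesis by (simp add: R.emeasure_space_1)
qed

text \<open>
  The unmatched mass is transported at cost at most \<open>|x|^r + |y|^r\<close>. Replacing \<open>|x|^r\<close> by \<open>|z|^r\<close>
  costs the spread once more, and turns the bound into an integral over the difference of the
  mollified densities.
\<close>

lemma excess_moment:
  assumes r: "0 < r" "r \<le> 1"
    and e: "\<And>x. (\<integral>\<^sup>+z. ennreal (norm (x - z) powr r * g x z) \<partial>lborel) \<le> e"
  shows "(\<integral>\<^sup>+x. ennreal (norm x powr r) * excess \<rho> \<mu> x \<partial>\<rho>)
    \<le> e + (\<integral>\<^sup>+z. ennreal (norm z powr r * max 0 (mollify \<rho> z - mollify \<mu> z)) \<partial>lborel)"
proof -
  note [measurable_cong] = \<rho>(2) \<mu>(2)
  have "(\<integral>\<^sup>+x. ennreal (norm x powr r) * excess \<rho> \<mu> x \<partial>\<rho>)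
    \<le> (\<integral>\<^sup>+x. (\<integral>\<^sup>+z. ennreal (norm (x - z) powr r * g x z) + ennreal (g x z) * ennreal (norm z powr r * deficit \<rho> \<mu> z) \<partial>lborel) \<partial>\<rho>)"
  proof (intro nn_integral_mono)
    fix x :: 'a
    have "ennreal (norm x powr r) * excess \<rho> \<mu> x
       = (\<integral>\<^sup>+z. ennreal (norm x powr r) * ennreal (g x z * deficit \<rho> \<mu> z) \<partial>lborel)"
      unfolding excess_def by (simp add: nn_integral_cmult)
    also have "\<dots> \<le> (\<integral>\<^sup>+z. ennreal (norm (x - z) powr r * g x z) + ennreal (g x z) * ennreal (norm z powr r * deficit \<rho> \<mu> z) \<partial>lborel)"
    proof (intro nn_integral_mono)
      fix z :: 'a
      have d: "0 \<le> deficit \<rho> \<mu> z" "deficit \<rho> \<mu> z \<le> 1" and g: "0 \<le> g x z"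
        using deficit_bounds[OF \<rho> \<mu>] less_imp_le[OF g_pos] by auto
      have "norm x powr r \<le> norm (x - z) powr r + norm z powr r"
        using norm_diff_powr_le[OF r, of x 0 z] by simp
      then have "norm x powr r * (g x z * deficit \<rho> \<mu> z) \<le> (norm (x - z) powr r + norm z powr r) * (g x z * deficit \<rho> \<mu> z)"
        using d g by (intro mult_right_mono) auto
      also have "\<dots> = (norm (x - z) powr r * g x z) * deficit \<rho> \<mu> z + g x z * (norm z powr r * deficit \<rho> \<mu> z)"
        by (simp add: algebra_simps)
      also have "\<dots> \<le> (norm (x - z) powr r * g x z) + g x z * (norm z powr r * deficit \<rho> \<mu> z)"
        using d g by (intro add_right_mono mult_left_le) auto
      finally show "ennreal (norm x powr r) * ennreal (g x z * deficit \<rho> \<mu> z) \<le> ennreal (norm (x - z) powr r * g x z) + ennreal (g x z) * ennreal (norm z powr r * deficit \<rho> \<mu> z)"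
        using d g by (simp add: ennreal_mult[symmetric] ennreal_plus[symmetric] del: ennreal_plus)
    qed
    finally show "ennreal (norm x powr r) * excess \<rho> \<mu> x \<le> \<dots>" .
  qed
  also have "\<dots> = (\<integral>\<^sup>+x. (\<integral>\<^sup>+z. ennreal (norm (x - z) powr r * g x z) \<partial>lborel) \<partial>\<rho>)
     + (\<integral>\<^sup>+x. (\<integral>\<^sup>+z. ennreal (g x z) * ennreal (norm z powr r * deficit \<rho> \<mu> z) \<partial>lborel) \<partial>\<rho>)"
    by (simp add: nn_integral_add)
  also have "\<dots> \<le> (\<integral>\<^sup>+x. e \<partial>\<rho>) + (\<integral>\<^sup>+x. (\<integral>\<^sup>+z. ennreal (g x z) * ennreal (norm z powr r * deficit \<rho> \<mu> z) \<partial>lborel) \<partial>\<rho>)"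
    by (intro add_right_mono nn_integral_mono e)
  also have "(\<integral>\<^sup>+x. (\<integral>\<^sup>+z. ennreal (g x z) * ennreal (norm z powr r * deficit \<rho> \<mu> z) \<partial>lborel) \<partial>\<rho>)
     = (\<integral>\<^sup>+z. (\<integral>\<^sup>+x. ennreal (g x z) * ennreal (norm z powr r * deficit \<rho> \<mu> z) \<partial>\<rho>) \<partial>lborel)"
    by (rule nn_integral_weighted_mollify[OF \<rho>]) measurable
  also have "\<dots> = (\<integral>\<^sup>+z. ennreal (norm z powr r * max 0 (mollify \<rho> z - mollify \<mu> z)) \<partial>lborel)"
  proof (intro nn_integral_cong)
    fix z :: 'a
    have "(\<integral>\<^sup>+x. ennreal (g x z) * ennreal (norm z powr r * deficit \<rho> \<mu> z) \<partial>\<rho>)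
       = ennreal (mollify \<rho> z) * ennreal (norm z powr r * deficit \<rho> \<mu> z)"
      by (simp add: nn_integral_multc nn_integral_g[OF \<rho>])
    also have "\<dots> = ennreal (norm z powr r * (mollify \<rho> z * deficit \<rho> \<mu> z))"
      by (simp add: ennreal_mult'[symmetric] less_imp_le[OF mollify_pos[OF \<rho>]] mult.left_commute)
    finally show "(\<integral>\<^sup>+x. ennreal (g x z) * ennreal (norm z powr r * deficit \<rho> \<mu> z) \<partial>\<rho>)
       = ennreal (norm z powr r * max 0 (mollify \<rho> z - mollify \<mu> z))"
      unfolding deficit_bounds(3)[OF \<rho> \<mu>] .
  qed
  finally show ?thesis by (simp add: R.emeasure_space_1)
qed

text \<open>
  The two excess functions have the same total mass: both complement the integral of
  \<open>min p m\<close>, which is symmetric. This makes their normalised product a coupling of the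
  unmatched masses.
\<close>

lemma integral_min_add_excess:
  "(\<integral>\<^sup>+z. ennreal (min (mollify \<rho> z) (mollify \<mu> z)) \<partial>lborel) + (\<integral>\<^sup>+x. excess \<rho> \<mu> x \<partial>\<rho>) = 1"
proof -
  note [measurable_cong] = \<rho>(2) \<mu>(2)
  have "(\<integral>\<^sup>+z. ennreal (min (mollify \<rho> z) (mollify \<mu> z)) \<partial>lborel) + (\<integral>\<^sup>+x. excess \<rho> \<mu> x \<partial>\<rho>)
    = (\<integral>\<^sup>+z. ennreal (min (mollify \<rho> z) (mollify \<mu> z)) + ennreal (max 0 (mollify \<rho> z - mollify \<mu> z)) \<partial>lborel)"
    unfolding integral_excess by (simp add: nn_integral_add)
  also have "\<dots> = (\<integral>\<^sup>+z. ennreal (mollify \<rho> z) \<partial>lborel)"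
  proof (intro nn_integral_cong)
    fix z
    have "min (mollify \<rho> z) (mollify \<mu> z) + max 0 (mollify \<rho> z - mollify \<mu> z) = mollify \<rho> z" by auto
    then show "ennreal (min (mollify \<rho> z) (mollify \<mu> z)) + ennreal (max 0 (mollify \<rho> z - mollify \<mu> z)) = ennreal (mollify \<rho> z)"
      using mollify_pos[OF \<rho>, of z] mollify_pos[OF \<mu>, of z] by (subst ennreal_plus[symmetric]) auto
  qed
  finally show ?thesis by (simp add: mollify_mass[OF \<rho>])
qed

end

text \<open>
  The plan is \<open>shared\<close> plus the normalised product of the two excesses. The factor 4 counts two legs
  of the matched mass and the two replacements of \<open>|x|^r\<close> and \<open>|y|^r\<close> by \<open>|z|^r\<close>.
\<close>

lemma transport_cost_le_mollify:
  fixes \<rho> \<mu> :: "'a measure"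
  assumes \<rho>: "prob_space \<rho>" "sets \<rho> = sets borel"
    and \<mu>: "prob_space \<mu>" "sets \<mu> = sets borel"
    and r: "0 < r" "r \<le> 1"
    and e: "\<And>x. (\<integral>\<^sup>+z. ennreal (norm (x - z) powr r * g x z) \<partial>lborel) \<le> e"
  shows "transport_cost r \<rho> \<mu> \<le> 4 * e + (\<integral>\<^sup>+z. ennreal (norm z powr r * \<bar>mollify \<rho> z - mollify \<mu> z\<bar>) \<partial>lborel)"
proof -
  interpret R: prob_space \<rho> by (rule \<rho>)
  interpret M: prob_space \<mu> by (rule \<mu>)
  interpret P: pair_sigma_finite \<rho> \<mu> ..
  interpret Q: pair_sigma_finite \<mu> \<rho> ..
  note [measurable_cong] = \<rho>(2) \<mu>(2)
  note [measurable] = mollify_measurable[OF \<rho>] mollify_measurable[OF \<mu>]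
    excess_measurable[OF \<rho> \<mu>] excess_measurable[OF \<mu> \<rho>] shared_measurable[OF \<rho> \<mu>]
  define \<tau> where "\<tau> = (\<integral>\<^sup>+x. excess \<rho> \<mu> x \<partial>\<rho>)"
  have \<tau>': "\<tau> = (\<integral>\<^sup>+y. excess \<mu> \<rho> y \<partial>\<mu>)" and \<tau>1: "\<tau> \<le> 1"
  proof -
    let ?m = "\<integral>\<^sup>+z. ennreal (min (mollify \<rho> z) (mollify \<mu> z)) \<partial>lborel"
    have 1: "?m + \<tau> = 1" unfolding \<tau>_def by (rule integral_min_add_excess[OF \<rho> \<mu>])
    have 2: "?m + (\<integral>\<^sup>+y. excess \<mu> \<rho> y \<partial>\<mu>) = 1"
      using integral_min_add_excess[OF \<mu> \<rho>] by (simp add: min.commute)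
    have "?m \<le> 1" unfolding 1[symmetric] by simp
    then have "?m \<noteq> \<top>" by (auto simp: top_unique)
    moreover have "?m + \<tau> = ?m + (\<integral>\<^sup>+y. excess \<mu> \<rho> y \<partial>\<mu>)"
      unfolding 1 2 ..
    ultimately show "\<tau> = (\<integral>\<^sup>+y. excess \<mu> \<rho> y \<partial>\<mu>)"
      unfolding ennreal_add_left_cancel by simp
    show "\<tau> \<le> 1" unfolding 1[symmetric] by simp
  qed
  \<comment> \<open>If \<open>\<tau> = 0\<close>, then \<open>\<tau> / \<tau> = 0\<close>, but the excesses vanish almost everywhere.\<close>
  have \<tau>self: "\<tau> / \<tau> = 1" if "\<tau> \<noteq> 0"
    using that \<tau>1 by (intro ennreal_divide_self) (auto intro: le_less_trans)
  then have \<tau>div: "\<tau> / \<tau> \<le> 1" by (cases "\<tau> = 0") auto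
  define H where "H p = shared \<rho> \<mu> (fst p) (snd p) + excess \<rho> \<mu> (fst p) * excess \<mu> \<rho> (snd p) / \<tau>" for p
  have H [measurable]: "H \<in> borel_measurable (borel \<Otimes>\<^sub>M borel)"
    unfolding H_def by measurable
  have cancel: "a * (\<tau> / \<tau>) = a" if "\<tau> = 0 \<Longrightarrow> a = 0" for a
    using that \<tau>self by (cases "\<tau> = 0") auto
  have m1: "AE x in \<rho>. (\<integral>\<^sup>+y. H (x, y) \<partial>\<mu>) = 1"
  proof -
    have z: "AE x in \<rho>. \<tau> = 0 \<longrightarrow> excess \<rho> \<mu> x = 0"
      unfolding \<tau>_def by (cases "(\<integral>\<^sup>+x. excess \<rho> \<mu> x \<partial>\<rho>) = 0") (auto simp: nn_integral_0_iff_AE)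
    then show ?thesis
    proof eventually_elim
      fix x assume x: "\<tau> = 0 \<longrightarrow> excess \<rho> \<mu> x = 0"
      have "(\<integral>\<^sup>+y. H (x, y) \<partial>\<mu>) = (\<integral>\<^sup>+y. shared \<rho> \<mu> x y \<partial>\<mu>) + excess \<rho> \<mu> x * (\<tau> / \<tau>)"
        unfolding H_def
        by (simp add: nn_integral_add nn_integral_cmult nn_integral_divide \<tau>'[symmetric] ennreal_times_divide[symmetric])
      then show "(\<integral>\<^sup>+y. H (x, y) \<partial>\<mu>) = 1"
        using x shared_marginal[OF \<rho> \<mu>] by (simp add: cancel)
    qed
  qed
  have m2: "AE y in \<mu>. (\<integral>\<^sup>+x. H (x, y) \<partial>\<rho>) = 1"
  proof -
    have z: "AE y in \<mu>. \<tau> = 0 \<longrightarrow> excess \<mu> \<rho> y = 0"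
      unfolding \<tau>' by (cases "(\<integral>\<^sup>+y. excess \<mu> \<rho> y \<partial>\<mu>) = 0") (auto simp: nn_integral_0_iff_AE)
    then show ?thesis
    proof eventually_elim
      fix y assume y: "\<tau> = 0 \<longrightarrow> excess \<mu> \<rho> y = 0"
      have "(\<integral>\<^sup>+x. H (x, y) \<partial>\<rho>) = (\<integral>\<^sup>+x. shared \<rho> \<mu> x y + excess \<mu> \<rho> y * (excess \<rho> \<mu> x / \<tau>) \<partial>\<rho>)"
        unfolding H_def by (simp add: ennreal_times_divide mult.commute)
      also have "\<dots> = (\<integral>\<^sup>+x. shared \<rho> \<mu> x y \<partial>\<rho>) + excess \<mu> \<rho> y * (\<tau> / \<tau>)"
        by (simp add: nn_integral_add nn_integral_cmult nn_integral_divide \<tau>_def[symmetric])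
      finally show "(\<integral>\<^sup>+x. H (x, y) \<partial>\<rho>) = 1"
        using y shared_marginal[OF \<mu> \<rho>, of y] by (simp add: cancel shared_commute[of \<rho> \<mu>])
    qed
  qed
  have coupling: "density (\<rho> \<Otimes>\<^sub>M \<mu>) H \<in> couplings \<rho> \<mu>"
    by (rule density_in_couplings) (use \<rho> \<mu> H m1 m2 in auto)
  let ?N = "\<lambda>x y :: 'a. ennreal (norm (x - y) powr r)"
  have split: "(\<integral>\<^sup>+p. ennreal (norm (fst p - snd p) powr r) \<partial>density (\<rho> \<Otimes>\<^sub>M \<mu>) H)
     = (\<integral>\<^sup>+x. (\<integral>\<^sup>+y. shared \<rho> \<mu> x y * ?N x y \<partial>\<mu>) \<partial>\<rho>)
     + (\<integral>\<^sup>+x. (\<integral>\<^sup>+y. excess \<rho> \<mu> x * excess \<mu> \<rho> y / \<tau> * ?N x y \<partial>\<mu>) \<partial>\<rho>)"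
  proof -
    have "(\<integral>\<^sup>+p. ennreal (norm (fst p - snd p) powr r) \<partial>density (\<rho> \<Otimes>\<^sub>M \<mu>) H)
      = (\<integral>\<^sup>+p. H p * ennreal (norm (fst p - snd p) powr r) \<partial>(\<rho> \<Otimes>\<^sub>M \<mu>))"
      by (rule nn_integral_density) measurable
    also have "\<dots> = (\<integral>\<^sup>+x. (\<integral>\<^sup>+y. H (x, y) * ?N x y \<partial>\<mu>) \<partial>\<rho>)"
      by (subst M.nn_integral_fst[symmetric]) auto
    also have "\<dots> = (\<integral>\<^sup>+x. (\<integral>\<^sup>+y. shared \<rho> \<mu> x y * ?N x y + excess \<rho> \<mu> x * excess \<mu> \<rho> y / \<tau> * ?N x y \<partial>\<mu>) \<partial>\<rho>)"
      by (simp add: H_def distrib_right)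
    finally show ?thesis by (simp add: nn_integral_add)
  qed
  have part1: "(\<integral>\<^sup>+x. (\<integral>\<^sup>+y. shared \<rho> \<mu> x y * ?N x y \<partial>\<mu>) \<partial>\<rho>) \<le> e + e"
  proof -
    let ?w = "\<lambda>x y z. ennreal (g x z * g y z / max (mollify \<rho> z) (mollify \<mu> z))"
    have "(\<integral>\<^sup>+x. (\<integral>\<^sup>+y. shared \<rho> \<mu> x y * ?N x y \<partial>\<mu>) \<partial>\<rho>)
      \<le> (\<integral>\<^sup>+x. (\<integral>\<^sup>+y. (\<integral>\<^sup>+z. ?N x z * ?w x y z + ?N y z * ?w x y z \<partial>lborel) \<partial>\<mu>) \<partial>\<rho>)"
    proof (intro nn_integral_mono)
      fix x y :: 'a
      have "shared \<rho> \<mu> x y * ?N x y = (\<integral>\<^sup>+z. ?w x y z * ?N x y \<partial>lborel)"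
        unfolding shared_def by (simp add: nn_integral_multc)
      also have "\<dots> \<le> (\<integral>\<^sup>+z. ?N x z * ?w x y z + ?N y z * ?w x y z \<partial>lborel)"
      proof (intro nn_integral_mono)
        fix z :: 'a
        have "?N x y \<le> ?N x z + ?N y z"
          using norm_diff_powr_le[OF r, of x y z]
          by (simp add: ennreal_plus[symmetric] ennreal_leI del: ennreal_plus)
        then have "?w x y z * ?N x y \<le> ?w x y z * (?N x z + ?N y z)"
          by (rule mult_left_mono) simp
        then show "?w x y z * ?N x y \<le> ?N x z * ?w x y z + ?N y z * ?w x y z"
          by (simp add: distrib_right mult.commute)
      qed
      finally show "shared \<rho> \<mu> x y * ?N x y \<le> \<dots>" .
    qed
    also have "\<dots> = (\<integral>\<^sup>+x. (\<integral>\<^sup>+y. (\<integral>\<^sup>+z. ?N x z * ?w x y z \<partial>lborel) \<partial>\<mu>) \<partial>\<rho>)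
        + (\<integral>\<^sup>+x. (\<integral>\<^sup>+y. (\<integral>\<^sup>+z. ?N y z * ?w x y z \<partial>lborel) \<partial>\<mu>) \<partial>\<rho>)"
      by (simp add: nn_integral_add)
    also have "(\<integral>\<^sup>+x. (\<integral>\<^sup>+y. (\<integral>\<^sup>+z. ?N y z * ?w x y z \<partial>lborel) \<partial>\<mu>) \<partial>\<rho>)
        = (\<integral>\<^sup>+y. (\<integral>\<^sup>+x. (\<integral>\<^sup>+z. ?N y z * ?w x y z \<partial>lborel) \<partial>\<rho>) \<partial>\<mu>)"
      by (rule P.Fubini'[symmetric]) measurable
    also have "\<dots> = (\<integral>\<^sup>+y. (\<integral>\<^sup>+x. (\<integral>\<^sup>+z. ?N y z * ennreal (g y z * g x z / max (mollify \<mu> z) (mollify \<rho> z)) \<partial>lborel) \<partial>\<rho>) \<partial>\<mu>)"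
      by (simp add: mult.commute max.commute)
    finally show ?thesis
      by (rule order_trans) (intro add_mono shared_cost[OF \<rho> \<mu> e] shared_cost[OF \<mu> \<rho> e])
  qed
  let ?A = "\<integral>\<^sup>+x. ennreal (norm x powr r) * excess \<rho> \<mu> x \<partial>\<rho>"
  let ?B = "\<integral>\<^sup>+y. ennreal (norm y powr r) * excess \<mu> \<rho> y \<partial>\<mu>"
  have part2: "(\<integral>\<^sup>+x. (\<integral>\<^sup>+y. excess \<rho> \<mu> x * excess \<mu> \<rho> y / \<tau> * ?N x y \<partial>\<mu>) \<partial>\<rho>) \<le> ?A + ?B"
  proof -
    let ?a = "\<lambda>x. ennreal (norm x powr r) * excess \<rho> \<mu> x"
    let ?b = "\<lambda>y. ennreal (norm y powr r) * excess \<mu> \<rho> y"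
    have "(\<integral>\<^sup>+x. (\<integral>\<^sup>+y. excess \<rho> \<mu> x * excess \<mu> \<rho> y / \<tau> * ?N x y \<partial>\<mu>) \<partial>\<rho>)
      \<le> (\<integral>\<^sup>+x. (\<integral>\<^sup>+y. ?a x * (excess \<mu> \<rho> y / \<tau>) + excess \<rho> \<mu> x / \<tau> * ?b y \<partial>\<mu>) \<partial>\<rho>)"
    proof (intro nn_integral_mono)
      fix x y :: 'a
      have "?N x y \<le> ennreal (norm x powr r) + ennreal (norm y powr r)"
        using norm_diff_powr_le[OF r, of x y 0]
        by (simp add: ennreal_plus[symmetric] ennreal_leI del: ennreal_plus)
      then have "excess \<rho> \<mu> x * excess \<mu> \<rho> y / \<tau> * ?N x y
         \<le> excess \<rho> \<mu> x * excess \<mu> \<rho> y / \<tau> * (ennreal (norm x powr r) + ennreal (norm y powr r))"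
        by (rule mult_left_mono) simp
      then show "excess \<rho> \<mu> x * excess \<mu> \<rho> y / \<tau> * ?N x y
         \<le> ?a x * (excess \<mu> \<rho> y / \<tau>) + excess \<rho> \<mu> x / \<tau> * ?b y"
        by (simp add: distrib_left distrib_right divide_ennreal_def mult_ac)
    qed
    also have "\<dots> = ?A * (\<tau> / \<tau>) + (\<tau> / \<tau>) * ?B"
      by (simp add: nn_integral_add nn_integral_cmult nn_integral_multc nn_integral_divide
          \<tau>'[symmetric] \<tau>_def[symmetric])
    also have "\<dots> \<le> ?A * 1 + 1 * ?B"
      by (intro add_mono mult_left_mono mult_right_mono \<tau>div) auto
    finally show ?thesis by simp
  qed
  have "?A + ?B \<le> (e + (\<integral>\<^sup>+z. ennreal (norm z powr r * max 0 (mollify \<rho> z - mollify \<mu> z)) \<partial>lborel))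
     + (e + (\<integral>\<^sup>+z. ennreal (norm z powr r * max 0 (mollify \<mu> z - mollify \<rho> z)) \<partial>lborel))"
    by (intro add_mono excess_moment[OF \<rho> \<mu> r e] excess_moment[OF \<mu> \<rho> r e])
  also have "\<dots> = (e + e) + (\<integral>\<^sup>+z. ennreal (norm z powr r * max 0 (mollify \<rho> z - mollify \<mu> z))
     + ennreal (norm z powr r * max 0 (mollify \<mu> z - mollify \<rho> z)) \<partial>lborel)"
    by (simp add: nn_integral_add ac_simps)
  also have "\<dots> = (e + e) + (\<integral>\<^sup>+z. ennreal (norm z powr r * \<bar>mollify \<rho> z - mollify \<mu> z\<bar>) \<partial>lborel)"
    by (intro arg_cong2[where f="(+)"] refl nn_integral_cong)
       (auto simp: max_def abs_if)
  finally have part2': "?A + ?B \<le> \<dots>" .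
  have "transport_cost r \<rho> \<mu> \<le> (\<integral>\<^sup>+p. ennreal (norm (fst p - snd p) powr r) \<partial>density (\<rho> \<Otimes>\<^sub>M \<mu>) H)"
    unfolding transport_cost_def by (rule INF_lower[OF coupling])
  also have "\<dots> \<le> (e + e) + ((e + e) + (\<integral>\<^sup>+z. ennreal (norm z powr r * \<bar>mollify \<rho> z - mollify \<mu> z\<bar>) \<partial>lborel))"
    unfolding split by (intro add_mono part1 order_trans[OF part2 part2'])
  also have "\<dots> = 4 * e + (\<integral>\<^sup>+z. ennreal (norm z powr r * \<bar>mollify \<rho> z - mollify \<mu> z\<bar>) \<partial>lborel)"
  proof -
    have "4 * e = (1 + 1 + 1 + 1) * e" by simp
    also have "\<dots> = (e + e) + (e + e)" by (simp only: distrib_right mult_1 add.assoc)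
    finally show ?thesis by (simp add: add.assoc)
  qed
  finally show ?thesis .
qed

end

section \<open>Gaussian integrals and the mixture formula for powers of the norm\<close>

definition gauss_mass :: "nat \<Rightarrow> real \<Rightarrow> real" where
  "gauss_mass n a = sqrt (pi / a) ^ n"

lemma gauss_mass_pos: "a > 0 \<Longrightarrow> gauss_mass n a > 0"
  by (simp add: gauss_mass_def)

lemma nn_integral_gauss_real:
  assumes "a > 0"
  shows "(\<integral>\<^sup>+t. ennreal (exp (- a * t\<^sup>2)) \<partial>lborel) = ennreal (sqrt (pi / a))"
proof -
  have "has_bochner_integral lborel (\<lambda>x::real. exp (- x\<^sup>2)) (2 * (sqrt pi / 2))"
    using has_bochner_integral_even_function[OF gaussian_moment_0] by simp
  then have 1: "(\<integral>\<^sup>+t. ennreal (exp (- t\<^sup>2)) \<partial>lborel) = ennreal (sqrt pi)"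
    by (simp add: has_bochner_integral_iff nn_integral_eq_integral)
  have "ennreal (sqrt pi) = ennreal (sqrt a) * (\<integral>\<^sup>+t. ennreal (exp (- a * t\<^sup>2)) \<partial>lborel)"
    unfolding 1[symmetric] using assms
    by (subst nn_integral_real_affine[where c="sqrt a" and t=0])
       (auto simp: power_mult_distrib real_sqrt_pow2)
  then have "ennreal (inverse (sqrt a)) * ennreal (sqrt pi) =
      ennreal (inverse (sqrt a)) * ennreal (sqrt a) * (\<integral>\<^sup>+t. ennreal (exp (- a * t\<^sup>2)) \<partial>lborel)"
    by (simp add: mult.assoc)
  also have "ennreal (inverse (sqrt a)) * ennreal (sqrt a) = 1"
    using assms by (simp add: ennreal_mult[symmetric])
  finally show ?thesis
    using assms by (simp add: ennreal_mult[symmetric] divide_inverse mult.commute real_sqrt_mult real_sqrt_inverse)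
qed

lemma nn_integral_gauss:
  fixes x :: "'a::euclidean_space"
  assumes "a > 0"
  shows "(\<integral>\<^sup>+z. ennreal (exp (- a * (norm (x - z))\<^sup>2)) \<partial>lborel) = ennreal (gauss_mass DIM('a) a)"
proof -
  have "(\<integral>\<^sup>+z. ennreal (exp (- a * (norm (x - z))\<^sup>2)) \<partial>lborel)
      = (\<integral>\<^sup>+z. ennreal (exp (- a * (norm z)\<^sup>2)) \<partial>distr lborel borel ((+) (- x)))"
    by (subst nn_integral_distr) (auto simp: norm_minus_commute)
  also have "\<dots> = (\<integral>\<^sup>+z. ennreal (exp (- a * (norm (z::'a))\<^sup>2)) \<partial>lborel)"
    by (simp add: lborel_distr_plus)
  also have "\<dots> = (\<integral>\<^sup>+z. (\<Prod>b\<in>Basis. ennreal (exp (- a * ((z::'a) \<bullet> b)\<^sup>2))) \<partial>lborel)"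
  proof (intro nn_integral_cong)
    fix z :: 'a
    have "(norm z)\<^sup>2 = (\<Sum>b\<in>Basis. (z \<bullet> b)\<^sup>2)"
      unfolding power2_norm_eq_inner by (subst euclidean_inner) (simp add: power2_eq_square)
    then show "ennreal (exp (- a * (norm z)\<^sup>2)) = (\<Prod>b\<in>Basis. ennreal (exp (- a * (z \<bullet> b)\<^sup>2)))"
      by (subst prod_ennreal) (auto simp: exp_sum[symmetric] sum_distrib_left sum_negf)
  qed
  also have "\<dots> = (\<Prod>b\<in>(Basis::'a set). (\<integral>\<^sup>+t. ennreal (exp (- a * t\<^sup>2)) \<partial>lborel))"
    by (rule nn_integral_lborel_prod) auto
  also have "\<dots> = ennreal (gauss_mass DIM('a) a)"
    unfolding nn_integral_gauss_real[OF assms]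
    using assms by (simp add: gauss_mass_def ennreal_power)
  finally show ?thesis .
qed

definition bump :: "real \<Rightarrow> 'a::euclidean_space \<Rightarrow> 'a \<Rightarrow> real" where
  "bump s x z = exp (- (2 * s) * (norm (x - z))\<^sup>2)"

lemma bump_pos: "bump s x z > 0" and bump_le_1: "s \<ge> 0 \<Longrightarrow> bump s x z \<le> 1"
  by (auto simp: bump_def)

lemma bump_measurable [measurable (raw)]:
  assumes [measurable]: "f \<in> borel_measurable M" "g \<in> borel_measurable M" "h \<in> borel_measurable M"
  shows "(\<lambda>w. bump (f w) (g w) (h w)) \<in> borel_measurable M"
  unfolding bump_def by measurable

text \<open>
  Parallelogram identity: \<open>|x - z|^2 + |y - z|^2 = |x - y|^2 / 2 + 2 |(x + y)/2 - z|^2\<close>. It makes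
  the Gaussian of \<open>x - y\<close> an \<open>L2\<close> inner product of bumps, without any Fourier transform.
\<close>

lemma bump_mult_eq:
  "bump s x z * bump s y z = exp (- s * (norm (x - y))\<^sup>2) * exp (- (4 * s) * (norm ((1/2) *\<^sub>R (x + y) - z))\<^sup>2)"
proof -
  have "2 * (norm (x - z))\<^sup>2 + 2 * (norm (y - z))\<^sup>2 =
      (norm (x - y))\<^sup>2 + 4 * (norm ((1/2) *\<^sub>R (x + y) - z))\<^sup>2"
    unfolding power2_norm_eq_inner
    by (simp add: inner_diff_left inner_diff_right inner_add_left inner_add_right
        inner_commute algebra_simps)
  then have "- (2 * s) * (norm (x - z))\<^sup>2 + - (2 * s) * (norm (y - z))\<^sup>2 =
      - s * (norm (x - y))\<^sup>2 + - (4 * s) * (norm ((1/2) *\<^sub>R (x + y) - z))\<^sup>2"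
    by algebra
  then show ?thesis
    by (simp add: bump_def exp_add[symmetric])
qed

lemma has_integral_bump_mult:
  fixes x :: "'a::euclidean_space"
  assumes "s > 0"
  shows "has_bochner_integral lborel (\<lambda>z. bump s x z * bump s y z)
    (exp (- s * (norm (x - y))\<^sup>2) * gauss_mass DIM('a) (4 * s))"
  unfolding bump_mult_eq
  by (intro has_bochner_integral_mult_right has_bochner_integral_nn_integral)
     (use nn_integral_gauss[of "4 * s"] assms gauss_mass_pos[of "4 * s"] in \<open>auto intro: less_imp_le\<close>)

lemma nn_integral_bump_diff_sq:
  fixes x :: "'a::euclidean_space"
  assumes "s > 0"
  shows "(\<integral>\<^sup>+z. ennreal ((bump s x z - bump s y z)\<^sup>2) \<partial>lborel)
    = ennreal (2 * gauss_mass DIM('a) (4 * s)) * ennreal (1 - exp (- s * (norm (x - y))\<^sup>2))"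
proof -
  have "has_bochner_integral lborel
     (\<lambda>z. bump s x z * bump s x z - bump s x z * bump s y z
         + (bump s y z * bump s y z - bump s x z * bump s y z))
     (exp (- s * (norm (x - x))\<^sup>2) * gauss_mass DIM('a) (4 * s)
       - exp (- s * (norm (x - y))\<^sup>2) * gauss_mass DIM('a) (4 * s)
       + (exp (- s * (norm (y - y))\<^sup>2) * gauss_mass DIM('a) (4 * s)
       - exp (- s * (norm (x - y))\<^sup>2) * gauss_mass DIM('a) (4 * s)))"
    by (intro has_bochner_integral_add has_bochner_integral_diff has_integral_bump_mult assms)
  also have "(\<lambda>z. bump s x z * bump s x z - bump s x z * bump s y z
         + (bump s y z * bump s y z - bump s x z * bump s y z)) = (\<lambda>z. (bump s x z - bump s y z)\<^sup>2)"
    by (auto simp: power2_eq_square algebra_simps)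
  finally have "has_bochner_integral lborel (\<lambda>z. (bump s x z - bump s y z)\<^sup>2)
     (2 * gauss_mass DIM('a) (4 * s) * (1 - exp (- s * (norm (x - y))\<^sup>2)))"
    by (simp add: algebra_simps)
  then show ?thesis
    using assms gauss_mass_pos[of "4 * s" "DIM('a)"]
    by (simp add: has_bochner_integral_iff nn_integral_eq_integral ennreal_mult[symmetric])
qed

definition radial_const :: "real \<Rightarrow> real" where
  "radial_const q = enn2real (\<integral>\<^sup>+s. ennreal (indicator {0<..} s * (1 - exp (- s)) * s powr (- 1 - q / 2)) \<partial>lborel)"

text \<open>
  Convergence at \<open>0\<close>, where \<open>1 - exp (- s) \<le> s\<close>, is due to \<open>q < 2\<close>, and at infinity to \<open>0 < q\<close>.
\<close>

lemma nn_radial_const: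
  assumes "0 < q" "q < 2"
  shows "(\<integral>\<^sup>+s. ennreal (indicator {0<..} s * (1 - exp (- s)) * s powr (- 1 - q / 2)) \<partial>lborel) = ennreal (radial_const q)"
    (is "?I = _")
   and "radial_const q > 0"
proof -
  have "?I \<le> (\<integral>\<^sup>+s. ennreal (s powr (- q / 2)) * indicator {0..1} s + ennreal (s powr (- 1 - q / 2)) * indicator {1..} s \<partial>lborel)"
  proof (intro nn_integral_mono)
    fix s :: real
    consider "s \<le> 0" | "0 < s" "s < 1" | "1 \<le> s" by linarith
    then show "ennreal (indicator {0<..} s * (1 - exp (- s)) * s powr (- 1 - q / 2)) \<le>
       ennreal (s powr (- q / 2)) * indicator {0..1} s + ennreal (s powr (- 1 - q / 2)) * indicator {1..} s"
    proof cases
      case 2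
      have "(1 - exp (- s)) * s powr (- 1 - q / 2) \<le> s powr 1 * s powr (- 1 - q / 2)"
        using 2 exp_ge_add_one_self[of "-s"] by (intro mult_right_mono) auto
      also have "\<dots> = s powr (1 + (- 1 - q / 2))"
        by (rule powr_add[symmetric])
      also have "\<dots> = s powr (- q / 2)" by simp
      finally show ?thesis using 2 by (auto intro!: ennreal_leI)
    next
      case 3
      then have "(1 - exp (- s)) * s powr (- 1 - q / 2) \<le> 1 * s powr (- 1 - q / 2)"
        by (intro mult_right_mono) auto
      then have "ennreal (indicator {0<..} s * (1 - exp (- s)) * s powr (- 1 - q / 2)) \<le> ennreal (s powr (- 1 - q / 2)) * indicator {1..} s"
        using 3 by (auto intro!: ennreal_leI)
      then show ?thesis by (rule order_trans) auto
    qed auto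
  qed
  also have "\<dots> = (\<integral>\<^sup>+s. ennreal (s powr (- q / 2)) * indicator {0..1} s \<partial>lborel) + (\<integral>\<^sup>+s. ennreal (s powr (- 1 - q / 2)) * indicator {1..} s \<partial>lborel)"
    by (rule nn_integral_add) auto
  also have "(\<integral>\<^sup>+s. ennreal (s powr (- q / 2)) * indicator {0..1} s \<partial>lborel) = ennreal (1 powr (- q / 2 + 1) / (- q / 2 + 1))"
    using assms has_integral_powr_from_0[of "- q / 2" 1]
    by (intro nn_integral_has_integral_lebesgue') auto
  also have "(\<integral>\<^sup>+s. ennreal (s powr (- 1 - q / 2)) * indicator {1..} s \<partial>lborel) = ennreal (-(1 powr (- 1 - q / 2 + 1) / (- 1 - q / 2 + 1)))"
    using assms has_integral_powr_to_inf[of "- 1 - q / 2" 1]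
    by (intro nn_integral_has_integral_lebesgue') auto
  finally have fin: "?I < \<infinity>"
    by (auto simp: order_le_less_trans ennreal_plus[symmetric] simp del: ennreal_plus)
  then show eq: "?I = ennreal (radial_const q)"
    unfolding radial_const_def by (simp add: less_top)
  have "?I \<noteq> 0"
  proof
    assume "?I = 0"
    then have "AE s in lborel. ennreal (indicator {0<..} s * (1 - exp (- s)) * s powr (- 1 - q / 2)) = 0"
      by (subst (asm) nn_integral_0_iff_AE) auto
    then have "AE s in lborel. s \<notin> {0<..<1::real}"
      by eventually_elim (auto simp: mult_le_0_iff ennreal_eq_0_iff not_le)
    then have "emeasure lborel {0<..<1::real} = 0"
      by (subst (asm) AE_iff_measurable[where N="{0<..<1}"]) auto
    then show False by simp
  qed
  then show "radial_const q > 0"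
    unfolding eq by (simp add: ennreal_eq_0_iff not_le)
qed

text \<open>
  Substituting \<open>t\<^sup>2 s\<close> for \<open>s\<close> in the integral that defines \<open>radial_const\<close> produces the factor
  \<open>t powr q\<close>.
\<close>

lemma nn_integral_radial:
  assumes q: "0 < q" "q < 2" and t: "t \<ge> 0"
  shows "(\<integral>\<^sup>+s. ennreal (indicator {0<..} s * (1 - exp (- s * t\<^sup>2)) * s powr (- 1 - q / 2)) \<partial>lborel)
    = ennreal (radial_const q * t powr q)"
proof (cases "t = 0")
  case False
  then have t: "t > 0" using assms by simp
  have *: "indicator {0<..} (t\<^sup>2 * s) * (1 - exp (- (t\<^sup>2 * s))) * (t\<^sup>2 * s) powr (- 1 - q / 2)
     = (t\<^sup>2) powr (- 1 - q / 2) * (indicator {0<..} s * (1 - exp (- s * t\<^sup>2)) * s powr (- 1 - q / 2))" for s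
    using t by (cases "s > 0") (auto simp: powr_mult indicator_def zero_less_mult_iff mult.commute)
  have pw: "t\<^sup>2 * (t\<^sup>2) powr (- 1 - q / 2) = t powr (- q)"
  proof -
    have "t\<^sup>2 = t powr 2" using t by simp
    then have "t\<^sup>2 * (t\<^sup>2) powr (- 1 - q / 2) = t powr 2 * t powr (2 * (- 1 - q/2))"
      by (simp only: powr_powr)
    also have "\<dots> = t powr (2 + 2 * (- 1 - q/2))" by (simp only: powr_add)
    also have "\<dots> = t powr (- q)" by simp
    finally show ?thesis .
  qed
  have "ennreal (radial_const q) = (\<integral>\<^sup>+s. ennreal (indicator {0<..} s * (1 - exp (- s)) * s powr (- 1 - q / 2)) \<partial>lborel)"
    using nn_radial_const[OF q] by simp
  also have "\<dots> = ennreal (t\<^sup>2) * (\<integral>\<^sup>+s. ennreal (indicator {0<..} (t\<^sup>2 * s) * (1 - exp (- (t\<^sup>2 * s))) * (t\<^sup>2 * s) powr (- 1 - q / 2)) \<partial>lborel)"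
    using t by (subst nn_integral_real_affine[where c="t\<^sup>2" and t=0]) auto
  also have "\<dots> = ennreal (t\<^sup>2 * (t\<^sup>2) powr (- 1 - q / 2)) * (\<integral>\<^sup>+s. ennreal (indicator {0<..} s * (1 - exp (- s * t\<^sup>2)) * s powr (- 1 - q / 2)) \<partial>lborel)"
    unfolding * by (subst ennreal_mult') (auto simp: nn_integral_cmult ennreal_mult' mult.assoc)
  finally have "ennreal (t powr q) * ennreal (radial_const q) = ennreal (t powr q) * ennreal (t powr (- q)) * (\<integral>\<^sup>+s. ennreal (indicator {0<..} s * (1 - exp (- s * t\<^sup>2)) * s powr (- 1 - q / 2)) \<partial>lborel)"
    unfolding pw by (simp add: mult.assoc)
  also have "ennreal (t powr q) * ennreal (t powr (- q)) = 1"
    using t by (simp add: ennreal_mult[symmetric] powr_add[symmetric])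
  finally show ?thesis
    using nn_radial_const(2)[OF q] by (simp add: ennreal_mult' mult.commute)
qed auto

section \<open>The maximum mean discrepancy as an L2 distance\<close>

lemma ennreal_power2_le_imp_le:
  fixes a b :: ennreal
  assumes "a\<^sup>2 \<le> b\<^sup>2"
  shows "a \<le> b"
proof (cases a)
  case (real r)
  show ?thesis
  proof (cases b)
    case (real r')
    with assms \<open>a = _\<close> \<open>0 \<le> r\<close> show ?thesis
      by (auto simp: ennreal_power ennreal_le_iff intro: power2_le_imp_le ennreal_leI)
  qed auto
next
  case top
  with assms show ?thesis
    by (cases b) (auto simp: ennreal_power top_unique)
qed

text \<open>
  Minkowski's integral inequality for the \<open>L2\<close> norm. The square of the inner integral is a double
  integral over two copies of \<open>N\<close>; after exchanging the order, Cauchy-Schwarz applies to each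
  pair of sections.
\<close>

lemma nn_integral_Minkowski:
  fixes F :: "'a \<Rightarrow> 'b \<Rightarrow> ennreal"
  assumes "sigma_finite_measure N" "sigma_finite_measure M"
    and F [measurable]: "(\<lambda>(x, w). F x w) \<in> borel_measurable (N \<Otimes>\<^sub>M M)"
    and c [measurable]: "c \<in> borel_measurable N"
    and bound: "\<And>x. x \<in> space N \<Longrightarrow> (\<integral>\<^sup>+w. (F x w)\<^sup>2 \<partial>M) \<le> (c x)\<^sup>2"
  shows "(\<integral>\<^sup>+w. (\<integral>\<^sup>+x. F x w \<partial>N)\<^sup>2 \<partial>M) \<le> (\<integral>\<^sup>+x. c x \<partial>N)\<^sup>2"
proof -
  interpret N: sigma_finite_measure N by fact
  interpret M: sigma_finite_measure M by fact
  interpret P: pair_sigma_finite N M ..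
  have "(\<integral>\<^sup>+w. (\<integral>\<^sup>+x. F x w \<partial>N)\<^sup>2 \<partial>M) = (\<integral>\<^sup>+w. (\<integral>\<^sup>+x. (\<integral>\<^sup>+y. F x w * F y w \<partial>N) \<partial>N) \<partial>M)"
  proof (intro nn_integral_cong)
    fix w assume w [measurable]: "w \<in> space M"
    show "(\<integral>\<^sup>+x. F x w \<partial>N)\<^sup>2 = (\<integral>\<^sup>+x. (\<integral>\<^sup>+y. F x w * F y w \<partial>N) \<partial>N)"
      by (simp add: nn_integral_cmult nn_integral_multc power2_eq_square)
  qed
  also have "\<dots> = (\<integral>\<^sup>+x. (\<integral>\<^sup>+w. (\<integral>\<^sup>+y. F x w * F y w \<partial>N) \<partial>M) \<partial>N)"
    by (rule P.Fubini') measurable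
  also have "\<dots> = (\<integral>\<^sup>+x. (\<integral>\<^sup>+y. (\<integral>\<^sup>+w. F x w * F y w \<partial>M) \<partial>N) \<partial>N)"
    by (intro nn_integral_cong P.Fubini') measurable
  also have "\<dots> \<le> (\<integral>\<^sup>+x. (\<integral>\<^sup>+y. c x * c y \<partial>N) \<partial>N)"
  proof (intro nn_integral_mono)
    fix x y assume xy [measurable]: "x \<in> space N" "y \<in> space N"
    have "(\<integral>\<^sup>+w. F x w * F y w \<partial>M)\<^sup>2 \<le> (\<integral>\<^sup>+w. (F x w)\<^sup>2 \<partial>M) * (\<integral>\<^sup>+w. (F y w)\<^sup>2 \<partial>M)"
      by (rule Cauchy_Schwarz_nn_integral) measurable
    also have "\<dots> \<le> (c x)\<^sup>2 * (c y)\<^sup>2"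
      by (intro mult_mono bound xy) auto
    finally show "(\<integral>\<^sup>+w. F x w * F y w \<partial>M) \<le> c x * c y"
      by (subst (asm) power_mult_distrib[symmetric]) (rule ennreal_power2_le_imp_le)
  qed
  also have "\<dots> = (\<integral>\<^sup>+x. c x \<partial>N)\<^sup>2"
    by (simp add: nn_integral_cmult nn_integral_multc power2_eq_square)
  finally show ?thesis .
qed

lemma Cauchy_Schwarz_integral:
  fixes f g :: "'a \<Rightarrow> real"
  assumes [measurable]: "f \<in> borel_measurable M" "g \<in> borel_measurable M"
    and f: "integrable M (\<lambda>x. (f x)\<^sup>2)" and g: "integrable M (\<lambda>x. (g x)\<^sup>2)"
  shows "integrable M (\<lambda>x. f x * g x)"
    and "(\<integral>\<^sup>+x. ennreal \<bar>f x * g x\<bar> \<partial>M) \<le> ennreal (sqrt (\<integral>x. (f x)\<^sup>2 \<partial>M) * sqrt (\<integral>x. (g x)\<^sup>2 \<partial>M))"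
    and "\<bar>\<integral>x. f x * g x \<partial>M\<bar> \<le> sqrt (\<integral>x. (f x)\<^sup>2 \<partial>M) * sqrt (\<integral>x. (g x)\<^sup>2 \<partial>M)"
proof -
  let ?A = "\<integral>x. (f x)\<^sup>2 \<partial>M" and ?B = "\<integral>x. (g x)\<^sup>2 \<partial>M"
  have "(\<integral>\<^sup>+x. ennreal \<bar>f x * g x\<bar> \<partial>M)\<^sup>2 = (\<integral>\<^sup>+x. ennreal \<bar>f x\<bar> * ennreal \<bar>g x\<bar> \<partial>M)\<^sup>2"
    by (simp add: abs_mult ennreal_mult)
  also have "\<dots> \<le> (\<integral>\<^sup>+x. (ennreal \<bar>f x\<bar>)\<^sup>2 \<partial>M) * (\<integral>\<^sup>+x. (ennreal \<bar>g x\<bar>)\<^sup>2 \<partial>M)"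
    by (rule Cauchy_Schwarz_nn_integral) measurable
  also have "\<dots> = ennreal ?A * ennreal ?B"
    using f g by (simp add: ennreal_power nn_integral_eq_integral)
  also have "\<dots> = (ennreal (sqrt ?A * sqrt ?B))\<^sup>2"
    by (simp add: ennreal_power power_mult_distrib ennreal_mult)
  finally show *: "(\<integral>\<^sup>+x. ennreal \<bar>f x * g x\<bar> \<partial>M) \<le> ennreal (sqrt ?A * sqrt ?B)"
    by (rule ennreal_power2_le_imp_le)
  show int: "integrable M (\<lambda>x. f x * g x)"
    unfolding integrable_iff_bounded using * by (auto intro: le_less_trans)
  have "ennreal \<bar>\<integral>x. f x * g x \<partial>M\<bar> \<le> (\<integral>\<^sup>+x. ennreal \<bar>f x * g x\<bar> \<partial>M)"
    using integral_norm_bound_ennreal[OF int] by simp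
  also note *
  finally show "\<bar>\<integral>x. f x * g x \<partial>M\<bar> \<le> sqrt ?A * sqrt ?B"
    by (subst (asm) ennreal_le_iff) auto
qed

text \<open>
  The value is cut off to \<open>0\<close> for \<open>s \<le> 0\<close> so that features are bounded by 1 everywhere and their
  means exist under every probability measure.
\<close>

definition feature :: "'a::euclidean_space \<Rightarrow> real \<times> 'a \<Rightarrow> real" where
  "feature x w = (if fst w > 0 then bump (fst w) x (snd w) else 0)"

text \<open>
  The factor \<open>gauss_mass n (4 * s)\<close> removes the normalisation of the bumps at scale \<open>s\<close>, and
  \<open>radial_const q\<close> that of the mixture over \<open>s\<close>.
\<close>

definition scale_weight :: "nat \<Rightarrow> real \<Rightarrow> real \<Rightarrow> real" where
  "scale_weight n q s = indicator {0<..} s * s powr (- 1 - q / 2) / (radial_const q * gauss_mass n (4 * s))"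

definition feature_measure :: "real \<Rightarrow> (real \<times> 'a::euclidean_space) measure" where
  "feature_measure q = density (lborel \<Otimes>\<^sub>M lborel) (\<lambda>w. ennreal (scale_weight DIM('a) q (fst w)))"

lemma gauss_mass_measurable [measurable]: "gauss_mass n \<in> borel_measurable borel"
  unfolding gauss_mass_def by measurable

lemma scale_weight_measurable [measurable]: "scale_weight n q \<in> borel_measurable borel"
  unfolding scale_weight_def by measurable

lemma feature_measurable [measurable (raw)]:
  assumes [measurable]: "f \<in> borel_measurable M" "g \<in> measurable M (borel \<Otimes>\<^sub>M borel)"
  shows "(\<lambda>w. feature (f w) (g w)) \<in> borel_measurable M"
  unfolding feature_def by measurable

lemma feature_measurable_point [measurable]: "(\<lambda>x. feature x w) \<in> borel_measurable borel"
  by (cases w) (simp add: feature_def)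

lemma feature_bounds: "0 \<le> feature x w" "feature x w \<le> 1"
  by (auto simp: feature_def bump_le_1 less_imp_le[OF bump_pos])

lemma sets_feature_measure [measurable_cong]: "sets (feature_measure q) = sets (borel \<Otimes>\<^sub>M borel)"
  unfolding feature_measure_def sets_density by (intro sets_pair_measure_cong) auto

lemma sigma_finite_feature_measure: "sigma_finite_measure (feature_measure q :: (real \<times> 'a::euclidean_space) measure)"
  unfolding feature_measure_def lborel_prod
  by (subst sigma_finite_measure.sigma_finite_iff_density_finite[OF sigma_finite_lborel])
     (auto simp: borel_prod[symmetric])

lemma nn_integral_feature_measure:
  fixes f :: "real \<times> 'a::euclidean_space \<Rightarrow> ennreal"
  assumes [measurable]: "f \<in> borel_measurable (borel \<Otimes>\<^sub>M borel)"
  shows "(\<integral>\<^sup>+w. f w \<partial>feature_measure q)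
    = (\<integral>\<^sup>+s. ennreal (scale_weight DIM('a) q s) * (\<integral>\<^sup>+z. f (s, z) \<partial>lborel) \<partial>lborel)"
proof -
  have "(\<integral>\<^sup>+w. f w \<partial>feature_measure q)
    = (\<integral>\<^sup>+w. ennreal (scale_weight DIM('a) q (fst w)) * f w \<partial>(lborel \<Otimes>\<^sub>M lborel))"
    unfolding feature_measure_def by (rule nn_integral_density) measurable
  also have "\<dots> = (\<integral>\<^sup>+s. (\<integral>\<^sup>+z. ennreal (scale_weight DIM('a) q s) * f (s, z) \<partial>lborel) \<partial>lborel)"
    by (subst lborel.nn_integral_fst[symmetric]) (auto simp: case_prod_beta)
  finally show ?thesis by (simp add: nn_integral_cmult)
qed

lemma sqrt2_powr_half_sq: "(sqrt 2 * t powr (q / 2))\<^sup>2 = 2 * t powr q"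
proof -
  have "(t powr (q / 2))\<^sup>2 = t powr (q / 2 + q / 2)"
    unfolding power2_eq_square powr_add ..
  then show ?thesis by (simp add: power_mult_distrib)
qed

lemma sqrt_two_powr: "sqrt (2 * t powr q) = sqrt 2 * t powr (q / 2)"
  by (intro real_sqrt_unique) (auto simp: sqrt2_powr_half_sq)

text \<open>
  A single feature is not square integrable over all scales, but differences of features are. Means
  of centred features differ from means of features by a constant that cancels between two
  probability measures.
\<close>

definition centred :: "'a::euclidean_space \<Rightarrow> real \<times> 'a \<Rightarrow> real" where
  "centred x w = feature x w - feature 0 w"

lemma centred_measurable [measurable (raw)]:
  assumes [measurable]: "f \<in> borel_measurable M" "g \<in> measurable M (borel \<Otimes>\<^sub>M borel)"
  shows "(\<lambda>w. centred (f w) (g w)) \<in> borel_measurable M"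
  unfolding centred_def by measurable

definition potential :: "'a::euclidean_space measure \<Rightarrow> real \<times> 'a \<Rightarrow> real" where
  "potential \<nu> w = (\<integral>x. feature x w \<partial>\<nu>)"

lemma prob_momentD:
  assumes "\<nu> \<in> prob_moment s"
  shows "prob_space \<nu>" "sets \<nu> = sets borel" "integrable \<nu> (\<lambda>x. norm x powr s)"
  using assms by (auto simp: prob_moment_def)

lemma potential_measurable:
  assumes "prob_space \<nu>" "sets \<nu> = sets borel"
  shows "potential \<nu> \<in> borel_measurable (borel \<Otimes>\<^sub>M borel)"
proof -
  interpret prob_space \<nu> by fact
  note assms(2) [measurable_cong]
  show ?thesis unfolding potential_def[abs_def] by measurable
qed

lemma integrable_feature:
  assumes "prob_space \<nu>" "sets \<nu> = sets borel"
  shows "integrable \<nu> (\<lambda>x. feature x w)"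
proof -
  interpret prob_space \<nu> by fact
  note assms(2) [measurable_cong]
  show ?thesis
    by (rule integrable_const_bound[where B=1]) (auto simp: feature_bounds)
qed

lemma integral_centred:
  assumes "prob_space \<nu>" "sets \<nu> = sets borel"
  shows "(\<integral>x. centred x w \<partial>\<nu>) = potential \<nu> w - feature 0 w"
proof -
  interpret prob_space \<nu> by fact
  show ?thesis
    unfolding centred_def potential_def using integrable_feature[OF assms] by (simp add: prob_space)
qed

context
  fixes q :: real
  assumes q: "0 < q" "q < 2"
begin

lemma feature_distance:
  fixes x y :: "'a::euclidean_space"
  shows "(\<integral>\<^sup>+w. ennreal ((feature x w - feature y w)\<^sup>2) \<partial>feature_measure q)
    = ennreal (2 * norm (x - y) powr q)"
proof -
  have "(\<integral>\<^sup>+w. ennreal ((feature x w - feature y w)\<^sup>2) \<partial>feature_measure q)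
     = (\<integral>\<^sup>+s. ennreal (2 / radial_const q) * ennreal (indicator {0<..} s * (1 - exp (- s * (norm (x - y))\<^sup>2)) * s powr (- 1 - q / 2)) \<partial>lborel)"
  proof (subst nn_integral_feature_measure, measurable, intro nn_integral_cong)
    fix s :: real
    show "ennreal (scale_weight DIM('a) q s) * (\<integral>\<^sup>+z. ennreal ((feature x (s, z) - feature y (s, z))\<^sup>2) \<partial>lborel)
      = ennreal (2 / radial_const q) * ennreal (indicator {0<..} s * (1 - exp (- s * (norm (x - y))\<^sup>2)) * s powr (- 1 - q / 2))"
      using gauss_mass_pos[of "4 * s" "DIM('a)"] nn_radial_const(2)[OF q]
      by (cases "s > 0") (simp_all add: feature_def nn_integral_bump_diff_sq scale_weight_def ennreal_mult[symmetric])
  qed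
  also have "\<dots> = ennreal (2 / radial_const q) * ennreal (radial_const q * norm (x - y) powr q)"
    using nn_integral_radial[OF q, of "norm (x - y)"] by (simp add: nn_integral_cmult)
  also have "\<dots> = ennreal (2 * norm (x - y) powr q)"
    using nn_radial_const(2)[OF q] by (simp add: ennreal_mult[symmetric])
  finally show ?thesis .
qed

lemma has_integral_feature_distance:
  fixes x y :: "'a::euclidean_space"
  shows "has_bochner_integral (feature_measure q) (\<lambda>w. (feature x w - feature y w)\<^sup>2) (2 * norm (x - y) powr q)"
  by (intro has_bochner_integral_nn_integral feature_distance) auto

lemma has_integral_centred_sq:
  "has_bochner_integral (feature_measure q) (\<lambda>w. (centred x w)\<^sup>2) (2 * norm x powr q)"
  using has_integral_feature_distance[of x 0] by (simp add: centred_def)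

text \<open>
  Polarisation: an inner product is determined by the norms of its arguments and of their
  difference.
\<close>

lemma mmd_kernel_feature:
  "(\<integral>w. centred x w * centred y w \<partial>feature_measure q) = mmd_kernel q x y"
proof -
  have "has_bochner_integral (feature_measure q)
     (\<lambda>w. ((centred x w)\<^sup>2 + (centred y w)\<^sup>2 - (feature x w - feature y w)\<^sup>2) / 2)
     ((2 * norm x powr q + 2 * norm y powr q - 2 * norm (x - y) powr q) / 2)"
    by (intro has_bochner_integral_divide has_bochner_integral_diff has_bochner_integral_add
        has_integral_feature_distance has_integral_centred_sq) 
  also have "(\<lambda>w. ((centred x w)\<^sup>2 + (centred y w)\<^sup>2 - (feature x w - feature y w)\<^sup>2) / 2)
     = (\<lambda>w. centred x w * centred y w)"
    by (auto simp: centred_def power2_eq_square field_simps)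
  finally show ?thesis by (simp add: has_bochner_integral_iff mmd_kernel_def)
qed

lemma integrable_sq_mean_centred:
  fixes \<nu> :: "'a::euclidean_space measure"
  assumes "\<nu> \<in> prob_moment (q / 2)"
  shows "integrable (feature_measure q) (\<lambda>w. (potential \<nu> w - feature 0 w)\<^sup>2)"
proof -
  note \<nu> = prob_momentD[OF assms]
  interpret prob_space \<nu> by (rule \<nu>)
  note \<nu>(2) [measurable_cong] 
  note potential_measurable[OF \<nu>(1,2), measurable]
  have "(\<integral>\<^sup>+w. ennreal ((potential \<nu> w - feature 0 w)\<^sup>2) \<partial>feature_measure q)
     \<le> (\<integral>\<^sup>+w. (\<integral>\<^sup>+x. ennreal \<bar>centred x w\<bar> \<partial>\<nu>)\<^sup>2 \<partial>feature_measure q)"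
  proof (intro nn_integral_mono)
    fix w
    have "integrable \<nu> (\<lambda>x. centred x w)"
      unfolding centred_def using integrable_feature[OF \<nu>(1,2)] by simp
    from integral_norm_bound_ennreal[OF this]
    have "ennreal \<bar>potential \<nu> w - feature 0 w\<bar> \<le> (\<integral>\<^sup>+x. ennreal \<bar>centred x w\<bar> \<partial>\<nu>)"
      by (simp add: integral_centred[OF \<nu>(1,2)])
    then show "ennreal ((potential \<nu> w - feature 0 w)\<^sup>2) \<le> (\<integral>\<^sup>+x. ennreal \<bar>centred x w\<bar> \<partial>\<nu>)\<^sup>2"
      using power_mono[of "ennreal \<bar>potential \<nu> w - feature 0 w\<bar>" _ 2] by (simp add: ennreal_power)
  qed
  also have "\<dots> \<le> (\<integral>\<^sup>+x. ennreal (sqrt 2 * norm x powr (q / 2)) \<partial>\<nu>)\<^sup>2"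
  proof (rule nn_integral_Minkowski)
    fix x :: 'a
    have "(\<integral>\<^sup>+w. (ennreal \<bar>centred x w\<bar>)\<^sup>2 \<partial>feature_measure q) = ennreal (2 * norm x powr q)"
      using feature_distance[of x 0] by (simp add: centred_def ennreal_power)
    also have "2 * norm x powr q = (sqrt 2 * norm x powr (q / 2))\<^sup>2"
      by (rule sqrt2_powr_half_sq[symmetric])
    finally show "(\<integral>\<^sup>+w. (ennreal \<bar>centred x w\<bar>)\<^sup>2 \<partial>feature_measure q) \<le> (ennreal (sqrt 2 * norm x powr (q / 2)))\<^sup>2"
      by (simp add: ennreal_power)
  qed (auto intro: sigma_finite_feature_measure sigma_finite_measure_axioms)
  also have "\<dots> < \<infinity>"
    using \<nu>(3) by (simp add: nn_integral_eq_integral ennreal_power)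
  finally show ?thesis
    unfolding integrable_iff_bounded by auto
qed

text \<open>
  Fubini's theorem. Cauchy-Schwarz bounds the inner absolute integral by a multiple of
  \<open>|x|^(q/2)\<close>, which explains the moment condition on \<open>\<nu>\<close>.
\<close>

lemma integral_test_function:
  fixes \<nu> :: "'a::euclidean_space measure"
  assumes \<nu>: "\<nu> \<in> prob_moment (q / 2)"
    and h [measurable]: "h \<in> borel_measurable (borel \<Otimes>\<^sub>M borel)"
    and h2: "integrable (feature_measure q) (\<lambda>w. (h w)\<^sup>2)"
  shows "integrable \<nu> (\<lambda>x. \<integral>w. h w * centred x w \<partial>feature_measure q)"
    and "integrable (feature_measure q) (\<lambda>w. h w * (potential \<nu> w - feature 0 w))"
    and "(\<integral>x. (\<integral>w. h w * centred x w \<partial>feature_measure q) \<partial>\<nu>)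
       = (\<integral>w. h w * (potential \<nu> w - feature 0 w) \<partial>feature_measure q)"
proof -
  note \<nu>' = prob_momentD[OF \<nu>]
  interpret prob_space \<nu> by (rule \<nu>')
  interpret M: sigma_finite_measure "feature_measure q :: (real \<times> 'a) measure"
    by (rule sigma_finite_feature_measure)
  interpret P: pair_sigma_finite \<nu> "feature_measure q :: (real \<times> 'a) measure" ..
  note \<nu>'(2) [measurable_cong] 
  have int: "integrable (\<nu> \<Otimes>\<^sub>M feature_measure q) (\<lambda>(x, w). h w * centred x w)"
    unfolding integrable_iff_bounded
  proof
    show "(\<lambda>(x, w). h w * centred x w) \<in> borel_measurable (\<nu> \<Otimes>\<^sub>M feature_measure q)"
      by measurable
    have "(\<integral>\<^sup>+p. ennreal (norm (case p of (x, w) \<Rightarrow> h w * centred x w)) \<partial>(\<nu> \<Otimes>\<^sub>M feature_measure q))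
       = (\<integral>\<^sup>+x. (\<integral>\<^sup>+w. ennreal \<bar>h w * centred x w\<bar> \<partial>feature_measure q) \<partial>\<nu>)"
      by (subst M.nn_integral_fst[symmetric]) (auto simp: case_prod_beta)
    also have "\<dots> \<le> (\<integral>\<^sup>+x. ennreal (sqrt (\<integral>w. (h w)\<^sup>2 \<partial>feature_measure q) * sqrt (2 * norm x powr q)) \<partial>\<nu>)"
    proof (intro nn_integral_mono)
      fix x :: 'a
      show "(\<integral>\<^sup>+w. ennreal \<bar>h w * centred x w\<bar> \<partial>feature_measure q) \<le> 
         ennreal (sqrt (\<integral>w. (h w)\<^sup>2 \<partial>feature_measure q) * sqrt (2 * norm x powr q))"
        using Cauchy_Schwarz_integral(2)[of h "feature_measure q" "centred x"] h2 has_integral_centred_sq[of x]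
        by (simp add: has_bochner_integral_iff)
    qed
    also have "\<dots> = (\<integral>\<^sup>+x. ennreal (sqrt (\<integral>w. (h w)\<^sup>2 \<partial>feature_measure q) * sqrt 2 * norm x powr (q / 2)) \<partial>\<nu>)"
      by (simp add: sqrt_two_powr mult.assoc)
    also have "\<dots> < \<infinity>"
      using nn_integral_eq_integral[OF integrable_mult_right[OF \<nu>'(3)],
          of "sqrt (\<integral>w. (h w)\<^sup>2 \<partial>feature_measure q) * sqrt 2"] by simp
    finally show "(\<integral>\<^sup>+p. ennreal (norm (case p of (x, w) \<Rightarrow> h w * centred x w)) \<partial>(\<nu> \<Otimes>\<^sub>M feature_measure q)) < \<infinity>" .
  qed
  show "integrable \<nu> (\<lambda>x. \<integral>w. h w * centred x w \<partial>feature_measure q)"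
    using P.integrable_fst[OF int] .
  show "integrable (feature_measure q) (\<lambda>w. h w * (potential \<nu> w - feature 0 w))"
    using P.integrable_snd[OF int] by (simp add: integral_centred[OF \<nu>'(1,2)])
  show "(\<integral>x. (\<integral>w. h w * centred x w \<partial>feature_measure q) \<partial>\<nu>)
       = (\<integral>w. h w * (potential \<nu> w - feature 0 w) \<partial>feature_measure q)"
    using P.Fubini_integral[OF int] by (simp add: integral_centred[OF \<nu>'(1,2)])
qed

context
  fixes \<rho> \<mu> :: "'a::euclidean_space measure"
  assumes \<rho>: "\<rho> \<in> prob_moment (q / 2)" and \<mu>: "\<mu> \<in> prob_moment (q / 2)"
begin

lemmas potentials_measurable =
  potential_measurable[OF prob_momentD(1,2)[OF \<rho>]] potential_measurable[OF prob_momentD(1,2)[OF \<mu>]]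

lemma integrable_potential_diff_sq:
  "integrable (feature_measure q) (\<lambda>w. (potential \<rho> w - potential \<mu> w)\<^sup>2)"
proof (rule Bochner_Integration.integrable_bound)
  note potentials_measurable [measurable]
  show "integrable (feature_measure q)
     (\<lambda>w. 2 * (potential \<rho> w - feature 0 w)\<^sup>2 + 2 * (potential \<mu> w - feature 0 w)\<^sup>2)"
    using integrable_sq_mean_centred[OF \<rho>] integrable_sq_mean_centred[OF \<mu>] by simp
  have *: "(a - b)\<^sup>2 \<le> 2 * (a - c)\<^sup>2 + 2 * (b - c)\<^sup>2" for a b c :: real
    using zero_le_power2[of "(a - c) + (b - c)"] by (simp add: power2_eq_square algebra_simps)
  show "AE w in feature_measure q. norm ((potential \<rho> w - potential \<mu> w)\<^sup>2) \<le>
     norm (2 * (potential \<rho> w - feature 0 w)\<^sup>2 + 2 * (potential \<mu> w - feature 0 w)\<^sup>2)"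
    by (intro AE_I2) (simp add: *)
  show "(\<lambda>w. (potential \<rho> w - potential \<mu> w)\<^sup>2) \<in> borel_measurable (feature_measure q)"
    by measurable
qed

lemma diff_integral_test_function:
  assumes h [measurable]: "h \<in> borel_measurable (borel \<Otimes>\<^sub>M borel)"
    and h2: "integrable (feature_measure q) (\<lambda>w. (h w)\<^sup>2)"
  shows "diff_integral \<rho> \<mu> (\<lambda>x. \<integral>w. h w * centred x w \<partial>feature_measure q)
       = (\<integral>w. h w * (potential \<rho> w - potential \<mu> w) \<partial>feature_measure q)"
  unfolding diff_integral_def integral_test_function(3)[OF \<rho> h h2] integral_test_function(3)[OF \<mu> h h2]
  by (subst Bochner_Integration.integral_diff[symmetric])
    (use integral_test_function(2)[OF \<rho> h h2] integral_test_function(2)[OF \<mu> h h2]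
     in \<open>auto simp: algebra_simps\<close>)

text \<open>
  Fubini's theorem is applied twice to the iterated integral of the kernel: with a centred feature as
  test function for the inner integral, and with the difference of the potentials for the outer
  one.
\<close>

lemma MMD_eq_L2:
  "MMD q \<rho> \<mu> = sqrt (1/2 * (\<integral>w. (potential \<rho> w - potential \<mu> w)\<^sup>2 \<partial>feature_measure q))"
proof -
  note potentials_measurable [measurable]
  have "diff_integral \<rho> \<mu> (\<lambda>x. mmd_kernel q x y)
      = (\<integral>w. (potential \<rho> w - potential \<mu> w) * centred y w \<partial>feature_measure q)" for y
  proof -
    have "diff_integral \<rho> \<mu> (\<lambda>x. mmd_kernel q x y)
      = diff_integral \<rho> \<mu> (\<lambda>x. \<integral>w. centred y w * centred x w \<partial>feature_measure q)"
      by (simp add: mmd_kernel_feature[symmetric] mult.commute)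
    also have "\<dots> = (\<integral>w. centred y w * (potential \<rho> w - potential \<mu> w) \<partial>feature_measure q)"
      using has_integral_centred_sq[of y]
      by (intro diff_integral_test_function) (auto simp: has_bochner_integral_iff)
    finally show ?thesis by (simp add: mult.commute)
  qed
  then have "diff_integral \<rho> \<mu> (\<lambda>y. diff_integral \<rho> \<mu> (\<lambda>x. mmd_kernel q x y))
     = (\<integral>w. (potential \<rho> w - potential \<mu> w) * (potential \<rho> w - potential \<mu> w) \<partial>feature_measure q)"
    using diff_integral_test_function[OF _ integrable_potential_diff_sq] by simp
  then show ?thesis
    by (simp add: MMD_def power2_eq_square)
qed

lemma MMD_nonneg: "0 \<le> MMD q \<rho> \<mu>"
  by (simp add: MMD_eq_L2)

lemma nn_integral_potential_diff_sq:
  "(\<integral>\<^sup>+w. ennreal ((potential \<rho> w - potential \<mu> w)\<^sup>2) \<partial>feature_measure q) = ennreal (2 * (MMD q \<rho> \<mu>)\<^sup>2)"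
  using integrable_potential_diff_sq by (simp add: nn_integral_eq_integral MMD_eq_L2)

lemma abs_diff_integral_test_function_le:
  assumes h [measurable]: "h \<in> borel_measurable (borel \<Otimes>\<^sub>M borel)"
    and h2: "integrable (feature_measure q) (\<lambda>w. (h w)\<^sup>2)"
  shows "\<bar>diff_integral \<rho> \<mu> (\<lambda>x. \<integral>w. h w * centred x w \<partial>feature_measure q)\<bar>
    \<le> sqrt (2 * (\<integral>w. (h w)\<^sup>2 \<partial>feature_measure q)) * MMD q \<rho> \<mu>"
proof -
  note potentials_measurable [measurable]
  show ?thesis
    unfolding diff_integral_test_function[OF h h2] MMD_eq_L2
    using Cauchy_Schwarz_integral(3)[OF _ _ h2 integrable_potential_diff_sq]
    by (simp add: real_sqrt_mult real_sqrt_divide field_simps)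
qed

lemma MMD_le_coupling:
  assumes \<pi>: "\<pi> \<in> couplings \<rho> \<mu>"
  shows "ennreal (MMD q \<rho> \<mu>) \<le> (\<integral>\<^sup>+p. ennreal (norm (fst p - snd p) powr (q / 2)) \<partial>\<pi>)"
proof -
  note \<rho>' = prob_momentD[OF \<rho>] and \<mu>' = prob_momentD[OF \<mu>]
  have pi: "prob_space \<pi>" "sets \<pi> = sets borel" "distr \<pi> borel fst = \<rho>" "distr \<pi> borel snd = \<mu>"
    using \<pi> by (auto simp: couplings_def)
  interpret prob_space \<pi> by (rule pi)
  have [measurable_cong]: "sets \<pi> = sets (borel \<Otimes>\<^sub>M borel)"
    unfolding borel_prod by (rule pi(2))
  have fst: "potential \<rho> w = (\<integral>p. feature (fst p) w \<partial>\<pi>)" for w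
    unfolding potential_def pi(3)[symmetric] by (subst integral_distr) auto
  have snd: "potential \<mu> w = (\<integral>p. feature (snd p) w \<partial>\<pi>)" for w
    unfolding potential_def pi(4)[symmetric] by (subst integral_distr) auto
  have ifst: "integrable \<pi> (\<lambda>p. feature (fst p) w)" and isnd: "integrable \<pi> (\<lambda>p. feature (snd p) w)" for w
    by (rule integrable_const_bound[where B=1]; auto simp: feature_bounds)+
  have "ennreal (2 * (MMD q \<rho> \<mu>)\<^sup>2)
     \<le> (\<integral>\<^sup>+w. (\<integral>\<^sup>+p. ennreal \<bar>feature (fst p) w - feature (snd p) w\<bar> \<partial>\<pi>)\<^sup>2 \<partial>feature_measure q)"
    unfolding nn_integral_potential_diff_sq[symmetric]
  proof (intro nn_integral_mono)
    fix w
    have int: "integrable \<pi> (\<lambda>p. feature (fst p) w - feature (snd p) w)"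
      using ifst isnd by simp
    have "ennreal \<bar>potential \<rho> w - potential \<mu> w\<bar> \<le> (\<integral>\<^sup>+p. ennreal \<bar>feature (fst p) w - feature (snd p) w\<bar> \<partial>\<pi>)"
      using integral_norm_bound_ennreal[OF int] by (simp add: fst snd ifst isnd)
    then show "ennreal ((potential \<rho> w - potential \<mu> w)\<^sup>2)
       \<le> (\<integral>\<^sup>+p. ennreal \<bar>feature (fst p) w - feature (snd p) w\<bar> \<partial>\<pi>)\<^sup>2"
      using power_mono[of "ennreal \<bar>potential \<rho> w - potential \<mu> w\<bar>" _ 2] by (simp add: ennreal_power)
  qed
  also have "\<dots> \<le> (\<integral>\<^sup>+p. ennreal (sqrt 2 * norm (fst p - snd p) powr (q / 2)) \<partial>\<pi>)\<^sup>2"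
  proof (rule nn_integral_Minkowski)
    fix p :: "'a \<times> 'a"
    have "(\<integral>\<^sup>+w. (ennreal \<bar>feature (fst p) w - feature (snd p) w\<bar>)\<^sup>2 \<partial>feature_measure q)
        = ennreal (2 * norm (fst p - snd p) powr q)"
      using feature_distance[of "fst p" "snd p"] by (simp add: ennreal_power)
    also have "2 * norm (fst p - snd p) powr q = (sqrt 2 * norm (fst p - snd p) powr (q / 2))\<^sup>2"
      by (rule sqrt2_powr_half_sq[symmetric])
    finally show "(\<integral>\<^sup>+w. (ennreal \<bar>feature (fst p) w - feature (snd p) w\<bar>)\<^sup>2 \<partial>feature_measure q)
        \<le> (ennreal (sqrt 2 * norm (fst p - snd p) powr (q / 2)))\<^sup>2"
      by (simp add: ennreal_power)
  qed (auto intro: sigma_finite_feature_measure sigma_finite_measure_axioms)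
  finally have "(ennreal (sqrt 2) * ennreal (MMD q \<rho> \<mu>))\<^sup>2 \<le> (ennreal (sqrt 2) * (\<integral>\<^sup>+p. ennreal (norm (fst p - snd p) powr (q / 2)) \<partial>\<pi>))\<^sup>2"
    using MMD_nonneg by (simp add: ennreal_power power_mult_distrib ennreal_mult nn_integral_cmult)
  then have "ennreal (sqrt 2) * ennreal (MMD q \<rho> \<mu>) \<le> ennreal (sqrt 2) * (\<integral>\<^sup>+p. ennreal (norm (fst p - snd p) powr (q / 2)) \<partial>\<pi>)"
    by (rule ennreal_power2_le_imp_le)
  then show ?thesis
    by (simp add: ennreal_mult_le_mult_iff)
qed

lemma MMD_le_transport_cost: "ennreal (MMD q \<rho> \<mu>) \<le> transport_cost (q / 2) \<rho> \<mu>"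
  unfolding transport_cost_def by (intro INF_greatest MMD_le_coupling)

end

end

section \<open>Smoothing by Gaussians\<close>

lemma gauss_mass_antimono: "0 < a \<Longrightarrow> a \<le> b \<Longrightarrow> gauss_mass n b \<le> gauss_mass n a"
  unfolding gauss_mass_def by (intro power_mono real_sqrt_le_mono divide_left_mono) auto

lemma gauss_mass_double: "a > 0 \<Longrightarrow> gauss_mass n a = sqrt 2 ^ n * gauss_mass n (2 * a)"
  by (simp add: gauss_mass_def power_mult_distrib[symmetric] real_sqrt_mult[symmetric])

definition gauss_kernel :: "real \<Rightarrow> 'a::euclidean_space \<Rightarrow> 'a \<Rightarrow> real" where
  "gauss_kernel s x z = bump s x z / gauss_mass DIM('a) (2 * s)"

lemma smoothing_kernel_gauss:
  assumes "s > 0"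
  shows "smoothing_kernel (gauss_kernel s :: 'a::euclidean_space \<Rightarrow> _) (1 / gauss_mass DIM('a) (2 * s))"
proof
  show "(\<lambda>(x::'a, z). gauss_kernel s x z) \<in> borel_measurable (borel \<Otimes>\<^sub>M borel)"
    unfolding gauss_kernel_def by measurable
  fix x z :: 'a
  show "0 < gauss_kernel s x z" "gauss_kernel s x z \<le> 1 / gauss_mass DIM('a) (2 * s)"
    using gauss_mass_pos[of "2 * s" "DIM('a)"] assms
    by (auto simp: gauss_kernel_def bump_pos intro!: divide_right_mono bump_le_1)
  have "(\<integral>\<^sup>+z. ennreal (gauss_kernel s x z) \<partial>lborel)
      = (\<integral>\<^sup>+z. ennreal (1 / gauss_mass DIM('a) (2 * s)) * ennreal (bump s x z) \<partial>lborel)"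
    using gauss_mass_pos[of "2 * s" "DIM('a)"] assms by (simp add: gauss_kernel_def ennreal_mult'[symmetric])
  also have "\<dots> = ennreal (1 / gauss_mass DIM('a) (2 * s)) * ennreal (gauss_mass DIM('a) (2 * s))"
    using nn_integral_gauss[of "2 * s" x] assms by (simp add: nn_integral_cmult bump_def)
  also have "\<dots> = 1"
    using gauss_mass_pos[of "2 * s" "DIM('a)"] assms by (simp add: ennreal_mult'[symmetric])
  finally show "(\<integral>\<^sup>+z. ennreal (gauss_kernel s x z) \<partial>lborel) = 1" .
qed

text \<open>
  The scaling \<open>s powr (- r / 2)\<close> comes from \<open>v^r \<le> 1 + v^2 \<le> exp (v^2)\<close> for \<open>v = sqrt s |x - z|\<close>: the
  factor \<open>exp (s |x - z|^2)\<close> is absorbed by half of the Gaussian exponent, and the ratio of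
  the two normalisations is \<open>sqrt 2\<close> to the dimension.
\<close>

lemma gauss_kernel_spread:
  fixes x :: "'a::euclidean_space"
  assumes s: "s > 0" and r: "0 < r" "r \<le> 2"
  shows "(\<integral>\<^sup>+z. ennreal (norm (x - z) powr r * gauss_kernel s x z) \<partial>lborel)
    \<le> ennreal (sqrt 2 ^ DIM('a) * s powr (- r / 2))"
proof -
  let ?G = "gauss_mass DIM('a) (2 * s)"
  have G: "?G > 0" using s by (simp add: gauss_mass_pos)
  have pw: "t powr r \<le> s powr (- r / 2) * exp (s * t\<^sup>2)" if "t \<ge> 0" for t
  proof -
    define v where "v = sqrt s * t"
    have v: "v \<ge> 0" using that s by (simp add: v_def)
    have "v powr r \<le> 1 + v\<^sup>2"
    proof (cases "v \<le> 1")
      case True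
      then have "v powr r \<le> 1 powr r" using v r by (intro powr_mono2) auto
      then have "v powr r \<le> 1" by simp
      also have "1 \<le> 1 + v\<^sup>2" by simp
      finally show ?thesis .
    next
      case False
      then have "v powr r \<le> v powr 2" using r by (intro powr_mono) auto
      then show ?thesis using False by simp
    qed
    also have "\<dots> \<le> exp (v\<^sup>2)" by (rule exp_ge_add_one_self)
    also have "v\<^sup>2 = s * t\<^sup>2" using s by (simp add: v_def power_mult_distrib)
    also have "v powr r = s powr (r / 2) * t powr r"
      using s that by (simp add: v_def powr_mult powr_half_sqrt[symmetric] powr_powr)
    finally have "s powr (- (r / 2)) * (s powr (r / 2) * t powr r) \<le> s powr (- (r / 2)) * exp (s * t\<^sup>2)"
      by (intro mult_left_mono) auto
    then show ?thesis using s by (simp add: mult.assoc[symmetric] powr_add[symmetric])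
  qed
  have "(\<integral>\<^sup>+z. ennreal (norm (x - z) powr r * gauss_kernel s x z) \<partial>lborel)
     \<le> (\<integral>\<^sup>+z. ennreal (s powr (- r / 2) / ?G) * ennreal (exp (- s * (norm (x - z))\<^sup>2)) \<partial>lborel)"
  proof (intro nn_integral_mono)
    fix z
    have "norm (x - z) powr r * gauss_kernel s x z
       \<le> s powr (- r / 2) * exp (s * (norm (x - z))\<^sup>2) * gauss_kernel s x z"
      using pw[of "norm (x - z)"] G bump_pos[of s x z] by (intro mult_right_mono) (auto simp: gauss_kernel_def)
    also have "\<dots> = s powr (- r / 2) / ?G * exp (- s * (norm (x - z))\<^sup>2)"
      by (simp add: gauss_kernel_def bump_def exp_add[symmetric] field_simps)
    finally show "ennreal (norm (x - z) powr r * gauss_kernel s x z)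
       \<le> ennreal (s powr (- r / 2) / ?G) * ennreal (exp (- s * (norm (x - z))\<^sup>2))"
      using G by (simp add: ennreal_mult'[symmetric] ennreal_leI)
  qed
  also have "\<dots> = ennreal (s powr (- r / 2) / ?G) * ennreal (gauss_mass DIM('a) s)"
    using nn_integral_gauss[OF s, of x] by (simp add: nn_integral_cmult)
  also have "\<dots> = ennreal (sqrt 2 ^ DIM('a) * s powr (- r / 2))"
    using G gauss_mass_double[OF s, of "DIM('a)"] by (simp add: ennreal_mult'[symmetric])
  finally show ?thesis .
qed

section \<open>From MMD to the transport cost\<close>

text \<open>
  Inside the ball this is Cauchy-Schwarz against its indicator; outside, \<open>|z|^r\<close> is at most
  \<open>R^(r - p) |z|^p\<close>.
\<close>

lemma weighted_L1_le:
  fixes d :: "'a::euclidean_space \<Rightarrow> real"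
  assumes [measurable]: "d \<in> borel_measurable borel"
    and rp: "0 < r" "r < p" and R: "R > 0"
    and D: "(\<integral>\<^sup>+z. ennreal ((d z)\<^sup>2) \<partial>lborel) \<le> ennreal D" "0 \<le> D"
  shows "(\<integral>\<^sup>+z. ennreal (norm z powr r * \<bar>d z\<bar>) \<partial>lborel)
    \<le> ennreal (R powr r * sqrt (D * measure lborel (cball (0::'a) R)))
      + ennreal (R powr (r - p)) * (\<integral>\<^sup>+z. ennreal (norm z powr p * \<bar>d z\<bar>) \<partial>lborel)"
proof -
  let ?B = "cball (0::'a) R"
  have [measurable]: "?B \<in> sets borel" by simp
  have "(\<integral>\<^sup>+z. ennreal \<bar>d z\<bar> * indicator ?B z \<partial>lborel)\<^sup>2
     \<le> (\<integral>\<^sup>+z. (ennreal \<bar>d z\<bar>)\<^sup>2 \<partial>lborel) * (\<integral>\<^sup>+z. (indicator ?B z)\<^sup>2 \<partial>lborel)"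
    by (rule Cauchy_Schwarz_nn_integral) measurable
  also have "\<dots> \<le> ennreal D * ennreal (measure lborel ?B)"
  proof (intro mult_mono)
    show "(\<integral>\<^sup>+z. (ennreal \<bar>d z\<bar>)\<^sup>2 \<partial>lborel) \<le> ennreal D"
      using D by (simp add: ennreal_power)
    have "(\<lambda>z. (indicator ?B z)\<^sup>2 :: ennreal) = indicator ?B"
      by (auto simp: indicator_def)
    then show "(\<integral>\<^sup>+z. (indicator ?B z)\<^sup>2 \<partial>lborel) \<le> ennreal (measure lborel ?B)"
      using emeasure_lborel_cball_finite[of "0::'a" R]
      by (simp add: emeasure_eq_ennreal_measure less_top)
  qed auto
  also have "\<dots> = (ennreal (sqrt (D * measure lborel ?B)))\<^sup>2"
    using D by (simp add: ennreal_power ennreal_mult')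
  finally have 1: "(\<integral>\<^sup>+z. ennreal \<bar>d z\<bar> * indicator ?B z \<partial>lborel) \<le> ennreal (sqrt (D * measure lborel ?B))"
    by (rule ennreal_power2_le_imp_le)
  have "(\<integral>\<^sup>+z. ennreal (norm z powr r * \<bar>d z\<bar>) \<partial>lborel)
     \<le> (\<integral>\<^sup>+z. ennreal (R powr r) * (ennreal \<bar>d z\<bar> * indicator ?B z)
         + ennreal (R powr (r - p)) * ennreal (norm z powr p * \<bar>d z\<bar>) \<partial>lborel)"
  proof (intro nn_integral_mono)
    fix z :: 'a
    show "ennreal (norm z powr r * \<bar>d z\<bar>) \<le> ennreal (R powr r) * (ennreal \<bar>d z\<bar> * indicator ?B z)
         + ennreal (R powr (r - p)) * ennreal (norm z powr p * \<bar>d z\<bar>)"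
    proof (cases "norm z \<le> R")
      case True
      then have "norm z powr r * \<bar>d z\<bar> \<le> R powr r * \<bar>d z\<bar>"
        using rp by (intro mult_right_mono powr_mono2) auto
      then have "ennreal (norm z powr r * \<bar>d z\<bar>) \<le> ennreal (R powr r) * (ennreal \<bar>d z\<bar> * indicator ?B z)"
        using True by (simp add: ennreal_mult'[symmetric] ennreal_leI)
      then show ?thesis by (rule order_trans) simp
    next
      case False
      have "norm z powr r = norm z powr (r - p) * norm z powr p"
        using False R by (simp add: powr_add[symmetric])
      also have "\<dots> \<le> R powr (r - p) * norm z powr p"
        using False R rp by (intro mult_right_mono powr_mono2') auto
      finally have "norm z powr r * \<bar>d z\<bar> \<le> R powr (r - p) * (norm z powr p * \<bar>d z\<bar>)"
        by (simp add: mult_right_mono mult.assoc[symmetric])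
      then have "ennreal (norm z powr r * \<bar>d z\<bar>) \<le> ennreal (R powr (r - p)) * ennreal (norm z powr p * \<bar>d z\<bar>)"
        by (simp add: ennreal_mult'[symmetric] ennreal_leI)
      then show ?thesis by (rule order_trans) simp
    qed
  qed
  also have "\<dots> = ennreal (R powr r) * (\<integral>\<^sup>+z. ennreal \<bar>d z\<bar> * indicator ?B z \<partial>lborel)
      + ennreal (R powr (r - p)) * (\<integral>\<^sup>+z. ennreal (norm z powr p * \<bar>d z\<bar>) \<partial>lborel)"
    by (simp add: nn_integral_add nn_integral_cmult)
  also have "\<dots> \<le> ennreal (R powr r) * ennreal (sqrt (D * measure lborel ?B))
      + ennreal (R powr (r - p)) * (\<integral>\<^sup>+z. ennreal (norm z powr p * \<bar>d z\<bar>) \<partial>lborel)"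
    by (intro add_right_mono mult_left_mono 1) auto
  finally show ?thesis by (simp add: ennreal_mult')
qed

lemma tendsto_zero_ennrealI:
  fixes f :: "nat \<Rightarrow> ennreal"
  assumes "\<And>\<epsilon>::real. \<epsilon> > 0 \<Longrightarrow> eventually (\<lambda>n. f n \<le> ennreal \<epsilon>) sequentially"
  shows "f \<longlonglongrightarrow> 0"
proof (rule order_tendstoI)
  fix a :: ennreal assume "0 < a"
  then obtain b where b: "0 < b" "b < a" using dense by blast
  then have "b < \<top>" using top.not_eq_extremum by fastforce
  with b have "enn2real b > 0" "b = ennreal (enn2real b)"
    by (auto simp: enn2real_positive_iff)
  with assms[of "enn2real b"] b show "eventually (\<lambda>n. f n < a) sequentially"
    by (auto elim!: eventually_mono)
qed auto

context
  fixes q :: real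
  assumes q: "0 < q" "q < 2"
begin

text \<open>
  A lower bound for \<open>scale_weight\<close> on \<open>[T, T + 1]\<close>: the power of \<open>s\<close> is smallest at the right end,
  and the Gaussian mass in the denominator is largest at the left end.
\<close>

definition min_weight :: "nat \<Rightarrow> real \<Rightarrow> real" where
  "min_weight n T = (T + 1) powr (- 1 - q / 2) / (radial_const q * gauss_mass n (4 * T))"

lemma min_weight_pos: "T > 0 \<Longrightarrow> min_weight n T > 0"
  using nn_radial_const(2)[OF q] gauss_mass_pos[of "4 * T" n] by (simp add: min_weight_def)

lemma min_weight_le:
  assumes "0 < T" "T \<le> s" "s \<le> T + 1"
  shows "min_weight n T \<le> scale_weight n q s"
proof -
  have "(T + 1) powr (- 1 - q / 2) / (radial_const q * gauss_mass n (4 * T))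
     \<le> s powr (- 1 - q / 2) / (radial_const q * gauss_mass n (4 * s))"
    using assms q nn_radial_const(2)[OF q] gauss_mass_pos[of "4 * s" n] gauss_mass_antimono[of "4 * T" "4 * s" n]
    by (intro frac_le powr_mono2' mult_left_mono mult_pos_pos) auto
  then show ?thesis using assms by (simp add: min_weight_def scale_weight_def)
qed

text \<open>
  \<open>MMD\<close> controls an integral over all scales, so it cannot control every single scale; but if the
  bound failed throughout \<open>[T, T + 1]\<close>, integrating over this interval would give
  \<open>K \<le> 2 * MMD\<^sup>2\<close>. The strict inequality in the hypothesis avoids null sets.
\<close>

lemma exists_scale_L2_le:
  fixes \<rho> \<mu> :: "'a::euclidean_space measure"
  assumes \<rho>: "\<rho> \<in> prob_moment (q / 2)" and \<mu>: "\<mu> \<in> prob_moment (q / 2)"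
    and T: "T > 0" and K: "2 * (MMD q \<rho> \<mu>)\<^sup>2 < K"
  shows "\<exists>s. T \<le> s \<and> s \<le> T + 1 \<and>
    (\<integral>\<^sup>+z. ennreal ((potential \<rho> (s, z) - potential \<mu> (s, z))\<^sup>2) \<partial>lborel) \<le> ennreal (K / min_weight DIM('a) T)"
proof (rule ccontr)
  let ?I = "\<lambda>s. \<integral>\<^sup>+z. ennreal ((potential \<rho> (s, z) - potential \<mu> (s, z))\<^sup>2) \<partial>lborel"
  let ?w = "min_weight DIM('a) T"
  note [measurable] = potential_measurable[OF prob_momentD(1,2)[OF \<rho>]] potential_measurable[OF prob_momentD(1,2)[OF \<mu>]]
  have w: "?w > 0" by (rule min_weight_pos[OF T])
  have K0: "0 \<le> K" using K zero_le_power2[of "MMD q \<rho> \<mu>"] by linarith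
  assume neg: "\<not> ?thesis"
  have "ennreal K = (\<integral>\<^sup>+s. ennreal K * indicator {T..T + 1} s \<partial>lborel)"
    by (simp add: nn_integral_cmult)
  also have "\<dots> \<le> (\<integral>\<^sup>+s. ennreal (scale_weight DIM('a) q s) * ?I s \<partial>lborel)"
  proof (intro nn_integral_mono)
    fix s
    show "ennreal K * indicator {T..T + 1} s \<le> ennreal (scale_weight DIM('a) q s) * ?I s"
    proof (cases "s \<in> {T..T + 1}")
      case True
      then have "\<not> ?I s \<le> ennreal (K / ?w)" using neg by auto
      then have "ennreal (K / ?w) \<le> ?I s" by simp
      then have "ennreal ?w * ennreal (K / ?w) \<le> ennreal (scale_weight DIM('a) q s) * ?I s"
        using True T by (intro mult_mono ennreal_leI min_weight_le) auto
      then show ?thesis using True w K0 by (simp add: ennreal_mult[symmetric])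
    qed auto
  qed
  also have "\<dots> = (\<integral>\<^sup>+w. ennreal ((potential \<rho> w - potential \<mu> w)\<^sup>2) \<partial>feature_measure q)"
    by (rule nn_integral_feature_measure[symmetric]) measurable
  also have "\<dots> = ennreal (2 * (MMD q \<rho> \<mu>)\<^sup>2)"
    by (rule nn_integral_potential_diff_sq[OF q \<rho> \<mu>])
  finally show False using K by (simp add: ennreal_le_iff2 not_le)
qed

text \<open>
  The quantitative form of the second implication: three terms, for the spread of the Gaussian, for
  the ball of radius \<open>R\<close> and for its complement. They are made small by choosing first \<open>T\<close>, then \<open>R\<close>,
  and finally \<open>K\<close>.
\<close>

lemma transport_cost_le_MMD:
  fixes \<rho> \<mu> :: "'a::euclidean_space measure"
  assumes \<rho>: "\<rho> \<in> prob_moment (q / 2)" and \<mu>: "\<mu> \<in> prob_moment (q / 2)"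
    and rp: "0 < r" "r < p" "p \<le> 1"
    and L: "(\<integral>\<^sup>+x. ennreal (norm x powr p) \<partial>\<rho>) \<le> ennreal L" "(\<integral>\<^sup>+x. ennreal (norm x powr p) \<partial>\<mu>) \<le> ennreal L" "0 \<le> L"
    and T: "T \<ge> 1" and R: "R > 0" and K: "2 * (MMD q \<rho> \<mu>)\<^sup>2 < K"
  shows "transport_cost r \<rho> \<mu> \<le> ennreal (4 * sqrt 2 ^ DIM('a) * T powr (- r / 2)
     + R powr r * sqrt (measure lborel (cball (0::'a) R) / min_weight DIM('a) T) / gauss_mass DIM('a) (2 * T + 2) * sqrt K
     + R powr (r - p) * (2 * L + 2 * sqrt 2 ^ DIM('a)))"
proof -
  let ?n = "DIM('a)" and ?S = "sqrt 2 ^ DIM('a)" and ?V = "measure lborel (cball (0::'a) R)"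
  note \<rho>' = prob_momentD(1,2)[OF \<rho>] and \<mu>' = prob_momentD(1,2)[OF \<mu>]
  have K0: "0 \<le> K" using K zero_le_power2[of "MMD q \<rho> \<mu>"] by linarith
  have T0: "T > 0" using T by simp
  obtain s where s: "T \<le> s" "s \<le> T + 1"
    and I: "(\<integral>\<^sup>+z. ennreal ((potential \<rho> (s, z) - potential \<mu> (s, z))\<^sup>2) \<partial>lborel) \<le> ennreal (K / min_weight ?n T)"
    using exists_scale_L2_le[OF \<rho> \<mu> T0 K] by blast
  have s0: "s > 0" using s T by simp
  define G where "G = gauss_mass ?n (2 * s)"
  define G' where "G' = gauss_mass ?n (2 * T + 2)"
  have G: "0 < G" "0 < G'" "G' \<le> G"
    unfolding G_def G'_def using s T by (auto intro!: gauss_mass_pos gauss_mass_antimono)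
  have w: "min_weight ?n T > 0" by (rule min_weight_pos[OF T0])
  interpret smoothing_kernel "gauss_kernel s :: 'a \<Rightarrow> _" "1 / gauss_mass DIM('a) (2 * s)"
    by (rule smoothing_kernel_gauss[OF s0])
  define d where "d z = mollify \<rho> z - mollify \<mu> z" for z
  note [measurable] = mollify_measurable[OF \<rho>'] mollify_measurable[OF \<mu>']
    potential_measurable[OF \<rho>'] potential_measurable[OF \<mu>']
  have [measurable]: "d \<in> borel_measurable borel" unfolding d_def by measurable
  have spread: "(\<integral>\<^sup>+z. ennreal (norm (x - z) powr a * gauss_kernel s x z) \<partial>lborel) \<le> ennreal (?S * T powr (- a / 2))"
    if "0 < a" "a \<le> 1" for a and x :: 'a
  proof -
    have "s powr (- a / 2) \<le> T powr (- a / 2)" using that s T by (intro powr_mono2') auto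
    then show ?thesis
      using that by (auto intro!: order_trans[OF gauss_kernel_spread[OF s0]] ennreal_leI mult_left_mono)
  qed
  have pot: "d z = (potential \<rho> (s, z) - potential \<mu> (s, z)) / G" for z
    using s0 by (simp add: d_def mollify_def potential_def feature_def gauss_kernel_def G_def diff_divide_distrib)
  have D: "(\<integral>\<^sup>+z. ennreal ((d z)\<^sup>2) \<partial>lborel) \<le> ennreal (K / min_weight ?n T / G'\<^sup>2)"
  proof -
    have "(\<integral>\<^sup>+z. ennreal ((d z)\<^sup>2) \<partial>lborel)
       \<le> (\<integral>\<^sup>+z. ennreal (1 / G'\<^sup>2) * ennreal ((potential \<rho> (s, z) - potential \<mu> (s, z))\<^sup>2) \<partial>lborel)"
    proof (intro nn_integral_mono)
      fix z
      have "(d z)\<^sup>2 \<le> 1 / G'\<^sup>2 * (potential \<rho> (s, z) - potential \<mu> (s, z))\<^sup>2"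
        unfolding pot power_divide using G by (auto intro!: divide_left_mono power_mono mult_pos_pos)
      then show "ennreal ((d z)\<^sup>2) \<le> ennreal (1 / G'\<^sup>2) * ennreal ((potential \<rho> (s, z) - potential \<mu> (s, z))\<^sup>2)"
        by (simp add: ennreal_mult'[symmetric] ennreal_leI)
    qed
    also have "\<dots> = ennreal (1 / G'\<^sup>2) * (\<integral>\<^sup>+z. ennreal ((potential \<rho> (s, z) - potential \<mu> (s, z))\<^sup>2) \<partial>lborel)"
      by (intro nn_integral_cmult) measurable
    also have "\<dots> \<le> ennreal (1 / G'\<^sup>2) * ennreal (K / min_weight ?n T)"
      by (intro mult_left_mono I) auto
    finally show ?thesis by (simp add: ennreal_mult'[symmetric] mult.commute)
  qed
  have "(\<integral>\<^sup>+z. ennreal (norm z powr p * \<bar>d z\<bar>) \<partial>lborel)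
     \<le> (\<integral>\<^sup>+z. ennreal (norm z powr p * mollify \<rho> z) + ennreal (norm z powr p * mollify \<mu> z) \<partial>lborel)"
  proof (intro nn_integral_mono)
    fix z
    have "norm z powr p * \<bar>d z\<bar> \<le> norm z powr p * mollify \<rho> z + norm z powr p * mollify \<mu> z"
      using mollify_pos[OF \<rho>', of z] mollify_pos[OF \<mu>', of z]
      by (auto simp: d_def distrib_left[symmetric] intro!: mult_left_mono)
    then show "ennreal (norm z powr p * \<bar>d z\<bar>) \<le> ennreal (norm z powr p * mollify \<rho> z) + ennreal (norm z powr p * mollify \<mu> z)"
      using mollify_pos[OF \<rho>', of z] mollify_pos[OF \<mu>', of z]
      by (simp add: ennreal_plus[symmetric] ennreal_leI del: ennreal_plus)
  qed
  also have "\<dots> = (\<integral>\<^sup>+z. ennreal (norm z powr p * mollify \<rho> z) \<partial>lborel) + (\<integral>\<^sup>+z. ennreal (norm z powr p * mollify \<mu> z) \<partial>lborel)"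
    by (rule nn_integral_add) measurable
  also have "\<dots> \<le> (ennreal L + ennreal ?S) + (ennreal L + ennreal ?S)"
  proof (intro add_mono)
    have "ennreal (?S * T powr (- p / 2)) \<le> ennreal ?S"
      using T rp powr_mono2'[of "- p / 2" 1 T] by (intro ennreal_leI mult_left_le) auto
    then have sp: "(\<integral>\<^sup>+z. ennreal (norm (x - z) powr p * gauss_kernel s x z) \<partial>lborel) \<le> ennreal ?S" for x :: 'a
      using spread[of p x] rp by (auto intro: order_trans)
    show "(\<integral>\<^sup>+z. ennreal (norm z powr p * mollify \<rho> z) \<partial>lborel) \<le> ennreal L + ennreal ?S"
      using mollify_moment[OF \<rho>' _ _ sp] rp add_right_mono[OF L(1), of "ennreal ?S"] by (auto intro: order_trans)
    show "(\<integral>\<^sup>+z. ennreal (norm z powr p * mollify \<mu> z) \<partial>lborel) \<le> ennreal L + ennreal ?S"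
      using mollify_moment[OF \<mu>' _ _ sp] rp add_right_mono[OF L(2), of "ennreal ?S"] by (auto intro: order_trans)
  qed
  also have "\<dots> = ennreal (2 * L + 2 * ?S)"
    using L(3) by (simp add: ennreal_plus[symmetric] del: ennreal_plus)
  finally have M: "(\<integral>\<^sup>+z. ennreal (norm z powr p * \<bar>d z\<bar>) \<partial>lborel) \<le> ennreal (2 * L + 2 * ?S)" .
  have sq: "sqrt (K / min_weight ?n T / G'\<^sup>2 * ?V) = sqrt (?V / min_weight ?n T) / G' * sqrt K"
    using G by (simp add: real_sqrt_mult real_sqrt_divide)
  have "transport_cost r \<rho> \<mu> \<le> 4 * ennreal (?S * T powr (- r / 2)) + (\<integral>\<^sup>+z. ennreal (norm z powr r * \<bar>d z\<bar>) \<partial>lborel)"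
    unfolding d_def using rp by (intro transport_cost_le_mollify \<rho>' \<mu>' spread) auto
  also have "\<dots> \<le> 4 * ennreal (?S * T powr (- r / 2)) + (ennreal (R powr r * sqrt (K / min_weight ?n T / G'\<^sup>2 * ?V))
      + ennreal (R powr (r - p)) * ennreal (2 * L + 2 * ?S))"
  proof (intro add_left_mono)
    have "(\<integral>\<^sup>+z. ennreal (norm z powr r * \<bar>d z\<bar>) \<partial>lborel)
     \<le> ennreal (R powr r * sqrt (K / min_weight ?n T / G'\<^sup>2 * ?V))
      + ennreal (R powr (r - p)) * (\<integral>\<^sup>+z. ennreal (norm z powr p * \<bar>d z\<bar>) \<partial>lborel)"
      using rp R D K0 w by (intro weighted_L1_le) auto
    also have "\<dots> \<le> ennreal (R powr r * sqrt (K / min_weight ?n T / G'\<^sup>2 * ?V))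
      + ennreal (R powr (r - p)) * ennreal (2 * L + 2 * ?S)"
      by (intro add_left_mono mult_left_mono M) auto
    finally show "(\<integral>\<^sup>+z. ennreal (norm z powr r * \<bar>d z\<bar>) \<partial>lborel) \<le> \<dots>" .
  qed
  also have "\<dots> = ennreal (4 * ?S * T powr (- r / 2)
     + R powr r * sqrt (?V / min_weight ?n T) / G' * sqrt K + R powr (r - p) * (2 * L + 2 * ?S))"
  proof -
    have 4: "4 * ennreal (?S * T powr (- r / 2)) = ennreal (4 * ?S * T powr (- r / 2))"
      by (simp add: ennreal_mult' mult.assoc)
    have 5: "0 \<le> R powr r * sqrt (?V / min_weight ?n T) / G' * sqrt K"
      using G w K0 by (intro mult_nonneg_nonneg divide_nonneg_nonneg) auto
    show ?thesis
      unfolding sq 4 using L(3) 5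
      by (simp add: ennreal_mult'[symmetric] ennreal_plus[symmetric] add.assoc mult.assoc del: ennreal_plus)
  qed
  finally show ?thesis unfolding G'_def .
qed

section \<open>Moments controlled by MMD\<close>

text \<open>
  Pairing the bump centred at \<open>0\<close> with a bump centred at \<open>x\<close> gives \<open>exp (- s |x|^2)\<close> at scale \<open>s\<close>.
  The power of \<open>s\<close> is chosen to turn the weight \<open>s^(-1 - q/2)\<close> into \<open>s^(-1 - p/2)\<close>, the one that
  represents \<open>|x|^p\<close>. Large \<open>|x|\<close> correspond to small \<open>s\<close>, hence the cut-off at \<open>s = 1\<close>.
\<close>

definition moment_test :: "real \<Rightarrow> real \<times> 'a::euclidean_space \<Rightarrow> real" where
  "moment_test p w = (if 0 < fst w \<and> fst w < 1 then fst w powr ((q - p) / 2) * bump (fst w) 0 (snd w) else 0)"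

lemma moment_test_measurable [measurable]: "moment_test p \<in> borel_measurable (borel \<Otimes>\<^sub>M borel)"
  unfolding moment_test_def[abs_def] by measurable

text \<open>
  At scale \<open>s\<close> the squared norm is \<open>s powr (q / 2 - p - 1)\<close> up to a constant; it is integrable near
  \<open>0\<close> because \<open>p < q / 2\<close>.
\<close>

lemma integrable_moment_test_sq:
  assumes p: "p < q / 2"
  shows "integrable (feature_measure q) (\<lambda>w. (moment_test p (w :: real \<times> 'a::euclidean_space))\<^sup>2)"
proof -
  let ?c = "radial_const q"
  have c: "?c > 0" by (rule nn_radial_const(2)[OF q])
  have "(\<integral>\<^sup>+w. ennreal ((moment_test p (w :: real \<times> 'a))\<^sup>2) \<partial>feature_measure q)
     = (\<integral>\<^sup>+s. ennreal (scale_weight DIM('a) q s) * (\<integral>\<^sup>+z. ennreal ((moment_test p (s, z :: 'a))\<^sup>2) \<partial>lborel) \<partial>lborel)"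
    by (rule nn_integral_feature_measure) measurable
  also have "\<dots> \<le> (\<integral>\<^sup>+s. ennreal (1 / ?c) * (ennreal (s powr (q / 2 - p - 1)) * indicator {0..1} s) \<partial>lborel)"
  proof (intro nn_integral_mono)
    fix s :: real
    show "ennreal (scale_weight DIM('a) q s) * (\<integral>\<^sup>+z. ennreal ((moment_test p (s, z :: 'a))\<^sup>2) \<partial>lborel)
       \<le> ennreal (1 / ?c) * (ennreal (s powr (q / 2 - p - 1)) * indicator {0..1} s)"
    proof (cases "0 < s \<and> s < 1")
      case True
      let ?G = "gauss_mass DIM('a) (4 * s)"
      have G: "?G > 0" using True by (simp add: gauss_mass_pos)
      have "(s powr ((q - p) / 2))\<^sup>2 = s powr ((q - p) / 2 + (q - p) / 2)"
        unfolding power2_eq_square powr_add ..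
      then have sq: "(moment_test p (s, z))\<^sup>2 = s powr (q - p) * (bump s 0 z * bump s 0 z)" for z :: 'a
        using True by (simp add: moment_test_def power_mult_distrib power2_eq_square[of "bump s 0 z"])
      have "has_bochner_integral lborel (\<lambda>z :: 'a. (moment_test p (s, z))\<^sup>2) (s powr (q - p) * ?G)"
        unfolding sq using has_integral_bump_mult[of s "0 :: 'a" 0] True
        by (intro has_bochner_integral_mult_right) auto
      then have "(\<integral>\<^sup>+z. ennreal ((moment_test p (s, z :: 'a))\<^sup>2) \<partial>lborel) = ennreal (s powr (q - p) * ?G)"
        by (simp add: has_bochner_integral_iff nn_integral_eq_integral)
      then have "ennreal (scale_weight DIM('a) q s) * (\<integral>\<^sup>+z. ennreal ((moment_test p (s, z :: 'a))\<^sup>2) \<partial>lborel)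
         = ennreal (s powr (- 1 - q / 2) * s powr (q - p) / ?c)"
        using True G c by (simp add: scale_weight_def ennreal_mult'[symmetric])
      also have "s powr (- 1 - q / 2) * s powr (q - p) = s powr (- 1 - q / 2 + (q - p))"
        by (rule powr_add[symmetric])
      also have "- 1 - q / 2 + (q - p) = q / 2 - p - 1" by (simp add: field_simps)
      finally show ?thesis using True c by (simp add: ennreal_mult'[symmetric])
    qed (auto simp: moment_test_def)
  qed
  also have "\<dots> = ennreal (1 / ?c) * (\<integral>\<^sup>+s. ennreal (s powr (q / 2 - p - 1)) * indicator {0..1} s \<partial>lborel)"
    by (rule nn_integral_cmult) measurable
  also have "(\<integral>\<^sup>+s. ennreal (s powr (q / 2 - p - 1)) * indicator {0..1} s \<partial>lborel)
      = ennreal (1 powr (q / 2 - p - 1 + 1) / (q / 2 - p - 1 + 1))"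
    using p has_integral_powr_from_0[of "q / 2 - p - 1" 1]
    by (intro nn_integral_has_integral_lebesgue') auto
  also have "ennreal (1 / ?c) * \<dots> < \<infinity>"
    by (simp add: ennreal_mult_less_top)
  finally show ?thesis
    unfolding integrable_iff_bounded by auto
qed

text \<open>
  The integrand of the mixture formula for \<open>t powr p\<close>, restricted to the scales below 1.
\<close>

definition radial_part :: "real \<Rightarrow> real \<Rightarrow> real \<Rightarrow> real" where
  "radial_part p t s = indicator {0<..<1} s * (s powr (- 1 - p / 2) * (1 - exp (- s * t\<^sup>2)))"

lemma moment_test_pairing:
  fixes x :: "'a::euclidean_space"
  assumes p: "p < q / 2"
  shows "integrable lborel (radial_part p (norm x))"
    and "(\<integral>w. moment_test p w * centred x w \<partial>feature_measure q) = - (\<integral>s. radial_part p (norm x) s \<partial>lborel) / radial_const q"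
proof -
  let ?c = "radial_const q"
  have c: "?c > 0" by (rule nn_radial_const(2)[OF q])
  have nonneg: "0 \<le> scale_weight DIM('a) q s" for s
    using c gauss_mass_pos[of "4 * s" "DIM('a)"] by (cases "s > 0") (auto simp: scale_weight_def)
  have "integrable (feature_measure q) (\<lambda>w. moment_test p w * centred x w)"
    using has_integral_centred_sq[OF q, of x] 
    by (intro Cauchy_Schwarz_integral(1) integrable_moment_test_sq p) (auto simp: has_bochner_integral_iff)
  then have int: "integrable (lborel \<Otimes>\<^sub>M lborel) (\<lambda>w. scale_weight DIM('a) q (fst w) * (moment_test p w * centred x w))"
    unfolding feature_measure_def by (subst (asm) integrable_density) (auto simp: nonneg)
  have inner: "(\<integral>z. scale_weight DIM('a) q s * (moment_test p (s, z) * centred x (s, z)) \<partial>lborel)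
     = - (1 / ?c) * radial_part p (norm x) s" for s
  proof (cases "0 < s \<and> s < 1")
    case True
    let ?G = "gauss_mass DIM('a) (4 * s)"
    have G: "?G > 0" using True by (simp add: gauss_mass_pos)
    have "has_bochner_integral lborel (\<lambda>z. s powr ((q - p) / 2) * (bump s 0 z * bump s x z - bump s 0 z * bump s 0 z))
       (s powr ((q - p) / 2) * (exp (- s * (norm (0 - x))\<^sup>2) * ?G - exp (- s * (norm (0 - 0 :: 'a))\<^sup>2) * ?G))"
      using True by (intro has_bochner_integral_mult_right has_bochner_integral_diff has_integral_bump_mult) auto
    also have "(\<lambda>z. s powr ((q - p) / 2) * (bump s 0 z * bump s x z - bump s 0 z * bump s 0 z))
       = (\<lambda>z. moment_test p (s, z) * centred x (s, z))"
      using True by (auto simp: moment_test_def centred_def feature_def algebra_simps)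
    finally have "(\<integral>z. moment_test p (s, z) * centred x (s, z) \<partial>lborel)
       = - (s powr ((q - p) / 2) * ?G * (1 - exp (- s * (norm x)\<^sup>2)))"
      by (simp add: has_bochner_integral_iff algebra_simps)
    then have "(\<integral>z. scale_weight DIM('a) q s * (moment_test p (s, z) * centred x (s, z)) \<partial>lborel)
       = scale_weight DIM('a) q s * (- (s powr ((q - p) / 2) * ?G * (1 - exp (- s * (norm x)\<^sup>2))))"
      by simp
    also have "\<dots> = - (1 / ?c) * ((s powr (- 1 - q / 2) * s powr ((q - p) / 2)) * (1 - exp (- s * (norm x)\<^sup>2)))"
      using True G c by (simp add: scale_weight_def)
    also have "s powr (- 1 - q / 2) * s powr ((q - p) / 2) = s powr (- 1 - q / 2 + (q - p) / 2)"
      by (rule powr_add[symmetric])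
    also have "- 1 - q / 2 + (q - p) / 2 = - 1 - p / 2" by (simp add: field_simps)
    finally show ?thesis using True by (simp add: radial_part_def)
  qed (auto simp: moment_test_def radial_part_def)
  have "integrable lborel (\<lambda>s. - (1 / ?c) * radial_part p (norm x) s)"
    using lborel_pair.integrable_fst'[OF int] by (simp only: fst_conv inner)
  then have "integrable lborel (\<lambda>s. - ?c * (- (1 / ?c) * radial_part p (norm x) s))"
    by (rule integrable_mult_right)
  then show "integrable lborel (radial_part p (norm x))" using c by simp
  have "(\<integral>w. moment_test p w * centred x w \<partial>feature_measure q)
     = (\<integral>w. scale_weight DIM('a) q (fst w) * (moment_test p w * centred x w) \<partial>(lborel \<Otimes>\<^sub>M lborel))"
    unfolding feature_measure_def by (subst integral_density) (auto simp: nonneg)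
  also have "\<dots> = (\<integral>s. - (1 / ?c) * radial_part p (norm x) s \<partial>lborel)"
    using lborel_pair.integral_fst'[OF int] by (simp only: fst_conv inner)
  also have "\<dots> = - (\<integral>s. radial_part p (norm x) s \<partial>lborel) / ?c"
    by simp
  finally show "(\<integral>w. moment_test p w * centred x w \<partial>feature_measure q) = \<dots>" .
qed

text \<open>
  For \<open>t > 1\<close> it suffices to integrate over \<open>1 / (2 t\<^sup>2) \<le> s < 1 / t\<^sup>2\<close>. There \<open>1 - exp (- s t\<^sup>2)\<close> is
  at least \<open>1/3\<close> and \<open>s powr (- 1 - p / 2)\<close> at least \<open>t powr (2 + p)\<close>, while the interval has length
  \<open>1 / (2 t\<^sup>2)\<close>; the constant 6 is the product of 3 and 2.
\<close>

lemma powr_le_radial_part: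
  assumes p: "0 < p" and t: "t \<ge> 0" and int: "integrable lborel (radial_part p t)"
  shows "t powr p \<le> 1 + 6 * (\<integral>s. radial_part p t s \<partial>lborel)"
proof -
  have nn: "0 \<le> radial_part p t s" for s
    by (auto simp: radial_part_def indicator_def)
  show ?thesis
  proof (cases "t \<le> 1")
    case True
    then have "t powr p \<le> 1 powr p" using p t by (intro powr_mono2) auto
    moreover have "0 \<le> (\<integral>s. radial_part p t s \<partial>lborel)" using nn by simp
    ultimately show ?thesis by simp
  next
    case False
    then have t1: "t > 1" by simp
    let ?J = "{1 / (2 * t\<^sup>2)..<1 / t\<^sup>2}"
    let ?c = "t powr (2 + p) / 3"
    have t2: "1 < t\<^sup>2" using t1 by (simp add: one_less_power)
    have ord: "1 / (2 * t\<^sup>2) \<le> 1 / t\<^sup>2" using t2 by (intro divide_left_mono) auto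
    have "t powr p / 6 = ?c * measure lborel ?J"
    proof -
      have "measure lborel ?J = 1 / t\<^sup>2 - 1 / (2 * t\<^sup>2)"
        by (rule measure_lborel_Ico[OF ord])
      then have "measure lborel ?J = 1 / (2 * t\<^sup>2)" by simp
      moreover have "t powr (2 + p) = t\<^sup>2 * t powr p" using t1 by (simp add: powr_add)
      ultimately show ?thesis using t1 by simp
    qed
    also have "\<dots> = (\<integral>s. ?c * indicator ?J s \<partial>lborel)" by simp
    also have "\<dots> \<le> (\<integral>s. radial_part p t s \<partial>lborel)"
    proof (rule integral_mono)
      show "integrable lborel (\<lambda>s. ?c * indicator ?J s)" 
        by (intro integrable_mult_right integrable_real_indicator) (simp_all add: emeasure_lborel_Ico[OF ord])
      fix s :: real
      show "?c * indicator ?J s \<le> radial_part p t s"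
      proof (cases "s \<in> ?J")
        case True
        have pos: "0 < 2 * t\<^sup>2" using t2 by linarith
        have J: "1 / (2 * t\<^sup>2) \<le> s" using True by simp
        have "1 \<le> s * (2 * t\<^sup>2)" using J unfolding pos_divide_le_eq[OF pos] .
        moreover have "0 < 1 / (2 * t\<^sup>2)" using pos by simp
        ultimately have s: "0 < s" "s < 1 / t\<^sup>2" "1 / 2 \<le> s * t\<^sup>2"
          using True J by (auto intro: less_le_trans simp del: zero_less_divide_iff)
        have "1 / t\<^sup>2 < 1" using divide_less_eq_1_pos[of "t\<^sup>2" 1] t2 by linarith
        with s(2) have s1: "s < 1" by (rule less_trans)
        have "exp (- (s * t\<^sup>2)) \<le> exp (- (1 / 2))" using s by simp
        also have "\<dots> \<le> 2 / 3"
          using exp_ge_add_one_self[of "1 / 2"] by (simp add: exp_minus field_simps)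
        finally have e: "1 / 3 \<le> 1 - exp (- s * t\<^sup>2)" by simp
        have "t powr (2 + p) = (1 / t\<^sup>2) powr (- 1 - p / 2)"
        proof -
          have "1 / t\<^sup>2 = t powr (- 2)" using t1 by (simp add: powr_minus field_simps)
          then have "(1 / t\<^sup>2) powr (- 1 - p / 2) = t powr (- 2 * (- 1 - p / 2))"
            by (simp only: powr_powr)
          then show ?thesis by (simp add: algebra_simps)
        qed
        also have "\<dots> \<le> s powr (- 1 - p / 2)" using s p by (intro powr_mono2') auto
        finally have "t powr (2 + p) * (1 / 3) \<le> s powr (- 1 - p / 2) * (1 - exp (- s * t\<^sup>2))"
          using e by (intro mult_mono) auto
        then show ?thesis using True s s1 by (simp add: radial_part_def)
      qed (simp add: nn)
    qed (rule int)
    finally show ?thesis by simp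
  qed
qed

text \<open>
  The test function \<open>F\<close> is nonpositive, and \<open>|x|^p \<le> 1 + C' (- F x)\<close> for a constant \<open>C'\<close>. Its means
  under \<open>\<rho>\<close> and \<open>\<mu>\<close> differ by at most a multiple of \<open>MMD q \<rho> \<mu>\<close>, which gives a bound that is
  uniform in \<open>\<rho>\<close>.
\<close>

lemma moment_bound:
  fixes \<mu> :: "'a::euclidean_space measure"
  assumes p: "0 < p" "p < q / 2" and \<mu>: "\<mu> \<in> prob_moment (q / 2)"
  shows "\<exists>L\<ge>0. \<forall>\<rho>. \<rho> \<in> prob_moment (q / 2) \<and> MMD q \<rho> \<mu> \<le> 1 \<longrightarrow>
    (\<integral>\<^sup>+x. ennreal (norm x powr p) \<partial>\<rho>) \<le> ennreal L"
proof -
  let ?c = "radial_const q"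
  have c: "?c > 0" by (rule nn_radial_const(2)[OF q])
  define F where "F x = (\<integral>w. moment_test p w * centred x w \<partial>feature_measure q)" for x :: 'a
  define C where "C = sqrt (2 * (\<integral>w. (moment_test p (w :: real \<times> 'a))\<^sup>2 \<partial>feature_measure q))"
  have F_nonpos: "F x \<le> 0" for x
  proof -
    have "0 \<le> (\<integral>s. radial_part p (norm x) s \<partial>lborel)"
      by (intro Bochner_Integration.integral_nonneg) (auto simp: radial_part_def indicator_def)
    then show ?thesis
      unfolding F_def moment_test_pairing(2)[OF p(2)] using c by simp
  qed
  have le: "norm x powr p \<le> 1 + 6 * ?c * (- F x)" for x
    using powr_le_radial_part[OF p(1) _ moment_test_pairing(1)[OF p(2), of x]] c
    unfolding F_def moment_test_pairing(2)[OF p(2)] by simp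
  define L where "L = 1 + 6 * ?c * (C - (\<integral>x. F x \<partial>\<mu>))"
  have "0 \<le> C" by (simp add: C_def)
  moreover have "(\<integral>x. F x \<partial>\<mu>) \<le> 0"
    using Bochner_Integration.integral_nonneg[of \<mu> "\<lambda>x. - F x"] F_nonpos by simp
  ultimately have "0 \<le> L" using c by (simp add: L_def)
  moreover have "(\<integral>\<^sup>+x. ennreal (norm x powr p) \<partial>\<rho>) \<le> ennreal L"
    if \<rho>: "\<rho> \<in> prob_moment (q / 2)" and M: "MMD q \<rho> \<mu> \<le> 1" for \<rho> :: "'a measure"
  proof -
    interpret prob_space \<rho> by (rule prob_momentD(1)[OF \<rho>])
    have int: "integrable \<rho> F"
      unfolding F_def using integral_test_function(1)[OF q \<rho> moment_test_measurable integrable_moment_test_sq[OF p(2)]] .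
    have "\<bar>(\<integral>x. F x \<partial>\<rho>) - (\<integral>x. F x \<partial>\<mu>)\<bar> \<le> C * MMD q \<rho> \<mu>"
      using abs_diff_integral_test_function_le[OF q \<rho> \<mu> moment_test_measurable integrable_moment_test_sq[OF p(2)]]
      unfolding diff_integral_def F_def C_def .
    also have "\<dots> \<le> C * 1" using M \<open>0 \<le> C\<close> by (intro mult_left_mono)
    finally have "- (\<integral>x. F x \<partial>\<rho>) \<le> C - (\<integral>x. F x \<partial>\<mu>)" by linarith
    then have *: "1 + 6 * ?c * (- (\<integral>x. F x \<partial>\<rho>)) \<le> L"
      unfolding L_def using c by (intro add_left_mono mult_left_mono) auto
    have "(\<integral>\<^sup>+x. ennreal (norm x powr p) \<partial>\<rho>) \<le> (\<integral>\<^sup>+x. ennreal (1 + 6 * ?c * (- F x)) \<partial>\<rho>)"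
      by (intro nn_integral_mono ennreal_leI le)
    also have "\<dots> = ennreal (\<integral>x. 1 + 6 * ?c * (- F x) \<partial>\<rho>)"
      using int by (intro nn_integral_eq_integral AE_I2 order_trans[OF _ le]) auto
    also have "(\<integral>x. 1 + 6 * ?c * (- F x) \<partial>\<rho>) = 1 + 6 * ?c * (- (\<integral>x. F x \<partial>\<rho>))"
      using int by (simp add: prob_space)
    also note *
    finally show ?thesis by (simp add: ennreal_leI)
  qed
  ultimately show ?thesis by blast
qed

section \<open>The two implications\<close>

lemma transport_cost_tendsto_zero:
  fixes \<mu>s :: "nat \<Rightarrow> 'a::euclidean_space measure"
  assumes \<mu>s: "\<And>n. \<mu>s n \<in> prob_moment (q / 2)" and \<mu>: "\<mu> \<in> prob_moment (q / 2)"
    and r: "0 < r" "r < q / 2" and lim: "(\<lambda>n. MMD q (\<mu>s n) \<mu>) \<longlonglongrightarrow> 0"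
  shows "(\<lambda>n. transport_cost r (\<mu>s n) \<mu>) \<longlonglongrightarrow> 0"
proof (rule tendsto_zero_ennrealI)
  fix \<epsilon> :: real assume \<epsilon>: "\<epsilon> > 0"
  \<comment> \<open>A moment of an order above \<open>r\<close> makes the tails of order \<open>r\<close> uniformly small.\<close>
  define p where "p = (r + q / 2) / 2"
  have p: "r < p" "p < q / 2" "p \<le> 1" "0 < p" using r q by (auto simp: p_def field_simps)
  obtain L where L: "0 \<le> L" "\<And>\<rho>. \<rho> \<in> prob_moment (q / 2) \<Longrightarrow> MMD q \<rho> \<mu> \<le> 1 \<Longrightarrow>
      (\<integral>\<^sup>+x. ennreal (norm x powr p) \<partial>\<rho>) \<le> ennreal L"
    using moment_bound[OF p(4,2) \<mu>] by blast
  have L\<mu>: "(\<integral>\<^sup>+x. ennreal (norm x powr p) \<partial>\<mu>) \<le> ennreal L"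
    by (rule L(2)[OF \<mu>]) (simp add: MMD_eq_L2[OF q \<mu> \<mu>])
  let ?S = "sqrt 2 ^ DIM('a)"
  have powr_small: "\<exists>t\<ge>1. A * t powr (- a) \<le> \<epsilon> / 3" if "0 < a" for A a :: real
  proof -
    have "((\<lambda>t. A * t powr (- a)) \<longlongrightarrow> A * 0) at_top"
      using that by (intro tendsto_mult tendsto_const tendsto_neg_powr filterlim_ident) auto
    then have "eventually (\<lambda>t. A * t powr (- a) < \<epsilon> / 3) at_top"
      using \<epsilon> by (intro order_tendstoD(2)) auto
    then have "eventually (\<lambda>t. 1 \<le> t \<and> A * t powr (- a) < \<epsilon> / 3) at_top"
      by (intro eventually_conj eventually_ge_at_top)
    then show ?thesis
      using eventually_happens[of _ "at_top :: real filter"] by (force intro: less_imp_le)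
  qed
  obtain T where T: "T \<ge> 1" "4 * ?S * T powr (- (r / 2)) \<le> \<epsilon> / 3"
    using powr_small[of "r / 2" "4 * ?S"] r by auto
  obtain R where R: "R \<ge> 1" "(2 * L + 2 * ?S) * R powr (- (p - r)) \<le> \<epsilon> / 3"
    using powr_small[of "p - r" "2 * L + 2 * ?S"] p by auto
  define A where "A = R powr r * sqrt (measure lborel (cball (0::'a) R) / min_weight DIM('a) T) / gauss_mass DIM('a) (2 * T + 2)"
  have A: "0 \<le> A"
    unfolding A_def using min_weight_pos[of T "DIM('a)"] T gauss_mass_pos[of "2 * T + 2" "DIM('a)"] by auto
  \<comment> \<open>With \<open>K = \<eta>\<^sup>2\<close> the contribution of the ball of radius \<open>R\<close> is at most \<open>A * \<eta>\<close>.\<close>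
  define \<eta> where "\<eta> = \<epsilon> / 3 / (A + 1)"
  have \<eta>: "\<eta> > 0" "A * \<eta> \<le> \<epsilon> / 3" using A \<epsilon> by (auto simp: \<eta>_def field_simps)
  have "(\<lambda>n. 2 * (MMD q (\<mu>s n) \<mu>)\<^sup>2) \<longlonglongrightarrow> 2 * 0\<^sup>2"
    by (intro tendsto_intros lim)
  then have "eventually (\<lambda>n. 2 * (MMD q (\<mu>s n) \<mu>)\<^sup>2 < \<eta>\<^sup>2) sequentially"
    by (rule order_tendstoD(2)) (use \<eta> in simp)
  moreover have "eventually (\<lambda>n. MMD q (\<mu>s n) \<mu> < 1) sequentially"
    using lim by (rule order_tendstoD(2)) simp
  ultimately show "eventually (\<lambda>n. transport_cost r (\<mu>s n) \<mu> \<le> ennreal \<epsilon>) sequentially"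
  proof eventually_elim
    case (elim n)
    have "transport_cost r (\<mu>s n) \<mu> \<le> ennreal (4 * ?S * T powr (- r / 2) + A * sqrt (\<eta>\<^sup>2)
       + R powr (r - p) * (2 * L + 2 * ?S))"
      unfolding A_def using elim r p L L\<mu> T R \<mu>s \<mu>
      by (intro transport_cost_le_MMD) auto
    also have "\<dots> \<le> ennreal \<epsilon>"
    proof (intro ennreal_leI)
      have "4 * ?S * T powr (- r / 2) \<le> \<epsilon> / 3" using T(2) by simp
      moreover have "A * sqrt (\<eta>\<^sup>2) \<le> \<epsilon> / 3" using \<eta> by simp
      moreover have "R powr (r - p) * (2 * L + 2 * ?S) \<le> \<epsilon> / 3" using R(2) by (simp add: mult.commute)
      ultimately show "4 * ?S * T powr (- r / 2) + A * sqrt (\<eta>\<^sup>2) + R powr (r - p) * (2 * L + 2 * ?S) \<le> \<epsilon>"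
        by linarith
    qed
    finally show ?case .
  qed
qed

end

lemma MMD_tendsto_zero:
  fixes \<mu>s :: "nat \<Rightarrow> 'a::euclidean_space measure"
  assumes q: "0 < q" "q < 2"
    and \<mu>s: "\<And>n. \<mu>s n \<in> prob_moment (q / 2)" and \<mu>: "\<mu> \<in> prob_moment (q / 2)"
    and lim: "(\<lambda>n. transport_cost (q / 2) (\<mu>s n) \<mu>) \<longlonglongrightarrow> 0"
  shows "(\<lambda>n. MMD q (\<mu>s n) \<mu>) \<longlonglongrightarrow> 0"
proof -
  have "(\<lambda>n. ennreal (MMD q (\<mu>s n) \<mu>)) \<longlonglongrightarrow> 0"
    by (rule tendsto_sandwich[OF _ _ tendsto_const lim])
      (auto simp: MMD_le_transport_cost[OF q \<mu>s \<mu>])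
  then show ?thesis
    using MMD_nonneg[OF q \<mu>s \<mu>] by (subst (asm) tendsto_ennreal_iff[where x=0, unfolded ennreal_0]) auto
qed

theorem propositionA4:
  fixes q :: real
    and \<mu>s :: "nat \<Rightarrow> (real ^ 'd) measure"
    and \<mu> :: "(real ^ 'd) measure"
  assumes "0 < q" and "q < 2"
    and "\<And>n. \<mu>s n \<in> prob_moment (q / 2)"
    and "\<mu> \<in> prob_moment (q / 2)"
  shows "((\<lambda>n. transport_cost (q / 2) (\<mu>s n) \<mu>) \<longlonglongrightarrow> 0 \<longrightarrow> (\<lambda>n. MMD q (\<mu>s n) \<mu>) \<longlonglongrightarrow> 0) \<and>
    ((\<lambda>n. MMD q (\<mu>s n) \<mu>) \<longlonglongrightarrow> 0 \<longrightarrow>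
      (\<forall>r. 0 < r \<and> r < q / 2 \<longrightarrow> (\<lambda>n. transport_cost r (\<mu>s n) \<mu>) \<longlonglongrightarrow> 0))"
  using MMD_tendsto_zero[of q \<mu>s \<mu>] transport_cost_tendsto_zero[of q \<mu>s \<mu>] assms by blast

end
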